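(* Let $(\{(A_t,L_t)\},\Gamma)$ be a continuous field of compact quantum metric spaces over a locally compact Hausdorff space $T$. Let $t_0\in T$, and let $\{f_n\}_{n\in\mathbb{N}}$ be a sequence in $\Gamma$ such that $(f_n)_{t_0}\in\mathcal{D}(A_{t_0})$ for each $n\in\mathbb{N}$ and the set $\{(f_n)_{t_0}:n\in\mathbb{N}\}$ is dense in $\mathcal{D}(A_{t_0})$. Then the following are equivalent: (i) $\mathrm{dist}_{\mathrm{oq}}(A_t,A_{t_0})\to0$ as $t\to t_0$; (ii) $\mathrm{dist}_{\mathrm{GH}}(\mathcal{D}(A_t),\mathcal{D}(A_{t_0}))\to0$ as $t\to t_0$; (iii) for any $\varepsilon>0$ there is an $N$ such that the open $\varepsilon$-balls in $A_t$ centered at $(f_1)_t,\dots,(f_N)_t$ cover $\mathcal{D}(A_t)$ for all $t$ in some neighborhood $\mathcal{U}$ of $t_0$.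
   Context: An order-unit space is a real partially ordered vector space $A$ with a distinguished element $e=e_A$ (the order unit) such that (i) for each $a\in A$ there is $r\in\mathbb{R}$ with $a\le re$; (ii) if $a\le re$ for all real $r>0$ then $a\le 0$. Its norm is $\|a\|=\inf\{r\in\mathbb{R}:-re\le a\le re\}$. A state is a $\mu$ in the dual $A'$ with $\mu(e)=\|\mu\|'=1$; $S(A)$ is the (nonempty) set of states with the weak-$*$ topology. For a seminorm $L$ on $A$ put $\rho_L(\mu,\nu)=\sup\{|\mu(a)-\nu(a)|:a\in A,\ L(a)\le1\}$. $L$ is a Lip-norm, and $(A,L)$ is a compact quantum metric space, if (1) $L(a)=0$ if and only if $a\in\mathbb{R}e$; (2) the topology on $S(A)$ induced by $\rho_L$ is the weak-$*$ topology. The radius $r_A$ is half the diameter of $(S(A),\rho_L)$. For $r\ge0$ let $\mathcal{D}_r(A)=\{a\in A:L(a)\le1,\ \|a\|\le r\}$, and let $\mathcal{D}(A)=\mathcal{D}_{r_A}(A)$, with the metric induced by the norm. $\mathrm{dist}_{\mathrm{H}}^X$ is the Hausdorff distance between nonempty subsets of a metric space $X$. $\mathrm{dist}_{\mathrm{GH}}(X,Y)=\inf\{\mathrm{dist}_{\mathrm{H}}^Z(h_X(X),h_Y(Y))\}$ over isometric embeddings $h_X,h_Y$ of $X,Y$ into a common metric space $Z$ (Gromov-Hausdorff distance). The order-unit quantum Gromov-Hausdorff distance is $$\mathrm{dist}_{\mathrm{oq}}(A,B)=\inf\max\big(\mathrm{dist}_{\mathrm{H}}^V(h_A(\mathcal{D}(A)),h_B(\mathcal{D}(B))),\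 \|h_A(r_Ae_A)-h_B(r_Be_B)\|\big),$$ the infimum being over all triples $(V,h_A,h_B)$ of a real normed space $V$ and linear isometric embeddings $h_A:A\to V$, $h_B:B\to V$. A continuous field of (real) Banach spaces over $T$ is a family $\{E_t\}_{t\in T}$ of Banach spaces with a linear subspace $\Gamma\subseteq\prod_tE_t$ (the continuous sections) such that: $\{f_t:f\in\Gamma\}$ is dense in $E_t$ for every $t$; $t\mapsto\|f_t\|$ is continuous for $f\in\Gamma$; and any $f\in\prod_tE_t$ that can, near each point of $T$ and for each $\varepsilon>0$, be approximated uniformly within $\varepsilon$ by an element of $\Gamma$ belongs to $\Gamma$. A continuous field of order-unit spaces is such a field in which each $E_t$ is a complete order-unit space with its order-unit norm and the unit section $t\mapsto e_{E_t}$ is in $\Gamma$. A continuous field of compact quantum metric spaces over $T$ consists of a compact quantum metric space $(A_t,L_t)$, with norm completion $\overline{A_t}$, for each $t\in T$, and the set $\Gamma$ of continuous sections of a continuous field of order-unit spaces over $T$ with fibres $\overline{A_t}$, such that for every $t\in T$, $a\in A_t$ and $\varepsilon>0$ there is $f\in\Gamma^L_t$ with $\|f_t-a\|<\varepsilon$ and $L_t(f_t)<L_t(a)+\varepsilon$. Here $L_t=+\infty$ on $\overline{A_t}\setminus A_t$, and $\Gamma^L_{t_0}$ is the set of $f\in\Gamma$ for which $t\mapsto L_t(f_t)$ is upper semi-continuous at $t_0$. In (iii), the centers $(f_n)_t$ lie in $\overline{A_t}$ and the balls are taken with respect to its norm. *)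

theory Defs
  imports "HOL-Analysis.Analysis"
begin

(* Vector spaces are linear subspaces of an ambient real vector space 'v, and all further structure
   (norm, order, seminorm) only matters on the carrier.  In particular the fibres of a field are
   subspaces of one ambient 'v that carries no norm or order of its own; every family of vector
   spaces is of this form up to isomorphism (take the direct sum). *)

definition linear_map_on :: "'v::real_vector set \<Rightarrow> ('v \<Rightarrow> 'w::real_vector) \<Rightarrow> bool" where
  "linear_map_on S h \<longleftrightarrow>
     (\<forall>x\<in>S. \<forall>y\<in>S. h (x + y) = h x + h y) \<and> (\<forall>c. \<forall>x\<in>S. h (c *\<^sub>R x) = c *\<^sub>R h x)"

definition seminorm_on :: "'v::real_vector set \<Rightarrow> ('v \<Rightarrow> real) \<Rightarrow> bool" where
  "seminorm_on S p \<longleftrightarrow>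
     (\<forall>x\<in>S. 0 \<le> p x) \<and> (\<forall>x\<in>S. \<forall>y\<in>S. p (x + y) \<le> p x + p y) \<and>
     (\<forall>c. \<forall>x\<in>S. p (c *\<^sub>R x) = \<bar>c\<bar> * p x)"

definition normed_space_on :: "'v::real_vector set \<Rightarrow> ('v \<Rightarrow> real) \<Rightarrow> bool" where
  "normed_space_on V N \<longleftrightarrow> subspace V \<and> seminorm_on V N \<and> (\<forall>x\<in>V. N x = 0 \<longrightarrow> x = 0)"

(* The value 0 off V is immaterial; it is there because the locale Metric_space asks for a
   distance that is nonnegative and symmetric on the whole type. *)
definition norm_dist :: "'v::real_vector set \<Rightarrow> ('v \<Rightarrow> real) \<Rightarrow> 'v \<Rightarrow> 'v \<Rightarrow> real" where
  "norm_dist V N x y = (if x \<in> V \<and> y \<in> V then N (x - y) else 0)"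

definition banach_on :: "'v::real_vector set \<Rightarrow> ('v \<Rightarrow> real) \<Rightarrow> bool" where
  "banach_on V N \<longleftrightarrow> normed_space_on V N \<and> Metric_space.mcomplete V (norm_dist V N)"

definition dense_for :: "('v \<Rightarrow> 'v \<Rightarrow> real) \<Rightarrow> 'v set \<Rightarrow> 'v set \<Rightarrow> bool" where
  "dense_for d X Y \<longleftrightarrow> X \<subseteq> Y \<and> (\<forall>y\<in>Y. \<forall>\<epsilon>>0. \<exists>x\<in>X. d x y < \<epsilon>)"

lemma Metric_space_norm_dist:
  assumes "normed_space_on V N"
  shows "Metric_space V (norm_dist V N)"
proof -
  have S: "subspace V" and sn: "seminorm_on V N" and z: "\<And>x. x \<in> V \<Longrightarrow> N x = 0 \<Longrightarrow> x = 0"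
    using assms by (auto simp: normed_space_on_def)
  have D: "x - y \<in> V" if "x \<in> V" "y \<in> V" for x y using S that by (rule subspace_diff)
  have N0: "N 0 = 0"
    using sn subspace_0[OF S] unfolding seminorm_on_def by (metis abs_zero mult_zero_left scaleR_zero_left)
  have sym: "N (x - y) = N (y - x)" if "x \<in> V" "y \<in> V" for x y
  proof -
    have "N ((-1) *\<^sub>R (x - y)) = \<bar>-1\<bar> * N (x - y)"
      using sn D[OF that] unfolding seminorm_on_def by blast
    then show ?thesis by simp
  qed
  show ?thesis
  proof
    show "0 \<le> norm_dist V N x y" for x y
      using sn D by (auto simp: norm_dist_def seminorm_on_def)
    show "norm_dist V N x y = norm_dist V N y x" for x y
      using sym by (auto simp: norm_dist_def)
    show "(norm_dist V N x y = 0) = (x = y)" if "x \<in> V" "y \<in> V" for x y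
      using that N0 z[OF D[OF that]] by (auto simp: norm_dist_def)
    show "norm_dist V N x w \<le> norm_dist V N x y + norm_dist V N y w"
      if "x \<in> V" "y \<in> V" "w \<in> V" for x y w
    proof -
      have "N ((x - y) + (y - w)) \<le> N (x - y) + N (y - w)"
        using sn D that unfolding seminorm_on_def by blast
      then show ?thesis using that by (simp add: norm_dist_def)
    qed
  qed
qed

record 'v ou_space =
  ou_carrier :: "'v set"
  ou_le :: "'v \<Rightarrow> 'v \<Rightarrow> bool"
  ou_unit :: 'v

(* The unit is required to be positive and nonzero.  This is part of the usual meaning of "order
   unit", and without it the order-unit norm and the state space degenerate (consider the real
   line with unit -1, or the zero space). *)
definition order_unit_space :: "('v::real_vector, 'm) ou_space_scheme \<Rightarrow> bool" where
  "order_unit_space A \<longleftrightarrow>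
     (let S = ou_carrier A; le = ou_le A; e = ou_unit A in
       subspace S \<and> reflp_on S le \<and> antisymp_on S le \<and> transp_on S le \<and>
       (\<forall>x\<in>S. \<forall>y\<in>S. \<forall>z\<in>S. le x y \<longrightarrow> le (x + z) (y + z)) \<and>
       (\<forall>x\<in>S. \<forall>y\<in>S. \<forall>c\<ge>0. le x y \<longrightarrow> le (c *\<^sub>R x) (c *\<^sub>R y)) \<and>
       e \<in> S \<and> e \<noteq> 0 \<and> le 0 e \<and>
       (\<forall>a\<in>S. \<exists>r. le a (r *\<^sub>R e)) \<and>
       (\<forall>a\<in>S. (\<forall>r>0. le a (r *\<^sub>R e)) \<longrightarrow> le a 0))"

definition ou_norm :: "('v::real_vector, 'm) ou_space_scheme \<Rightarrow> 'v \<Rightarrow> real" where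
  "ou_norm A a = Inf {r. ou_le A (- (r *\<^sub>R ou_unit A)) a \<and> ou_le A a (r *\<^sub>R ou_unit A)}"

definition ou_dist :: "('v::real_vector, 'm) ou_space_scheme \<Rightarrow> 'v \<Rightarrow> 'v \<Rightarrow> real" where
  "ou_dist A = norm_dist (ou_carrier A) (ou_norm A)"

definition dual_norm :: "('v::real_vector, 'm) ou_space_scheme \<Rightarrow> ('v \<Rightarrow> real) \<Rightarrow> ennreal" where
  "dual_norm A \<mu> = (SUP a\<in>{a \<in> ou_carrier A. ou_norm A a \<le> 1}. ennreal \<bar>\<mu> a\<bar>)"

(* Functionals on the carrier are represented by extensional functions, so that different elements
   of the set below are different functionals. *)
definition states :: "('v::real_vector, 'm) ou_space_scheme \<Rightarrow> ('v \<Rightarrow> real) set" where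
  "states A = {\<mu> \<in> extensional (ou_carrier A).
     linear_map_on (ou_carrier A) \<mu> \<and> \<mu> (ou_unit A) = 1 \<and> dual_norm A \<mu> = 1}"

definition weak_star_topology ::
    "('v::real_vector, 'm) ou_space_scheme \<Rightarrow> ('v \<Rightarrow> real) topology" where
  "weak_star_topology A = subtopology (powertop_real (ou_carrier A)) (states A)"

record 'v qms = "'v ou_space" +
  lip :: "'v \<Rightarrow> real"

(* A priori this may be infinite. *)
definition rho :: "('v::real_vector, 'm) qms_scheme \<Rightarrow> ('v \<Rightarrow> real) \<Rightarrow> ('v \<Rightarrow> real) \<Rightarrow> ennreal" where
  "rho A \<mu> \<nu> = (SUP a\<in>{a \<in> ou_carrier A. lip A a \<le> 1}. ennreal \<bar>\<mu> a - \<nu> a\<bar>)"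

definition rho_open :: "('v::real_vector, 'm) qms_scheme \<Rightarrow> ('v \<Rightarrow> real) set \<Rightarrow> bool" where
  "rho_open A U \<longleftrightarrow>
     U \<subseteq> states A \<and> (\<forall>\<mu>\<in>U. \<exists>\<epsilon>>0. \<forall>\<nu>\<in>states A. rho A \<mu> \<nu> < \<epsilon> \<longrightarrow> \<nu> \<in> U)"

definition rho_topology :: "('v::real_vector, 'm) qms_scheme \<Rightarrow> ('v \<Rightarrow> real) topology" where
  "rho_topology A = topology (rho_open A)"

lemma istopology_rho_open: "istopology (rho_open A)"
  unfolding istopology_def
proof (intro conjI allI impI)
  fix U V assume U: "rho_open A U" and V: "rho_open A V"
  show "rho_open A (U \<inter> V)"
    unfolding rho_open_def
  proof (intro conjI ballI)
    show "U \<inter> V \<subseteq> states A" using U by (auto simp: rho_open_def)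
    fix \<mu> assume "\<mu> \<in> U \<inter> V"
    then obtain e1 e2 where "e1 > 0" "\<forall>\<nu>\<in>states A. rho A \<mu> \<nu> < e1 \<longrightarrow> \<nu> \<in> U"
      and "e2 > 0" "\<forall>\<nu>\<in>states A. rho A \<mu> \<nu> < e2 \<longrightarrow> \<nu> \<in> V"
      using U V unfolding rho_open_def by blast
    then show "\<exists>\<epsilon>>0. \<forall>\<nu>\<in>states A. rho A \<mu> \<nu> < \<epsilon> \<longrightarrow> \<nu> \<in> U \<inter> V"
      by (intro exI[of _ "min e1 e2"]) auto
  qed
next
  fix \<K> assume K: "\<forall>K\<in>\<K>. rho_open A K"
  show "rho_open A (\<Union>\<K>)"
    unfolding rho_open_def
  proof (intro conjI ballI)
    show "\<Union>\<K> \<subseteq> states A" using K by (auto simp: rho_open_def)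
    fix \<mu> assume "\<mu> \<in> \<Union>\<K>"
    then obtain U where "U \<in> \<K>" "\<mu> \<in> U" by blast
    then show "\<exists>\<epsilon>>0. \<forall>\<nu>\<in>states A. rho A \<mu> \<nu> < \<epsilon> \<longrightarrow> \<nu> \<in> \<Union>\<K>"
      using K unfolding rho_open_def by (meson UnionI)
  qed
qed

lemma openin_rho_topology: "openin (rho_topology A) U \<longleftrightarrow> rho_open A U"
  by (simp add: rho_topology_def istopology_rho_open)

definition compact_qms :: "('v::real_vector, 'm) qms_scheme \<Rightarrow> bool" where
  "compact_qms A \<longleftrightarrow>
     order_unit_space A \<and> seminorm_on (ou_carrier A) (lip A) \<and>
     (\<forall>a\<in>ou_carrier A. lip A a = 0 \<longleftrightarrow> (\<exists>r. a = r *\<^sub>R ou_unit A)) \<and>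
     rho_topology A = weak_star_topology A"

(* For a compact quantum metric space the diameter is finite, so enn2real loses nothing. *)
definition qms_radius :: "('v::real_vector, 'm) qms_scheme \<Rightarrow> real" where
  "qms_radius A = enn2real (SUP \<mu>\<in>states A. SUP \<nu>\<in>states A. rho A \<mu> \<nu>) / 2"

definition lip_ball_r :: "('v::real_vector, 'm) qms_scheme \<Rightarrow> real \<Rightarrow> 'v set" where
  "lip_ball_r A r = {a \<in> ou_carrier A. lip A a \<le> 1 \<and> ou_norm A a \<le> r}"

definition lip_ball :: "('v::real_vector, 'm) qms_scheme \<Rightarrow> 'v set" where
  "lip_ball A = lip_ball_r A (qms_radius A)"

(* Distances take values in ennreal, so that all suprema and infima are the true ones. *)
definition hausdorff_dist :: "('z \<Rightarrow> 'z \<Rightarrow> real) \<Rightarrow> 'z set \<Rightarrow> 'z set \<Rightarrow> ennreal" where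
  "hausdorff_dist d X Y =
     max (SUP x\<in>X. INF y\<in>Y. ennreal (d x y)) (SUP y\<in>Y. INF x\<in>X. ennreal (d x y))"

lemma hausdorff_dist_image:
  assumes "\<And>x y. x \<in> X \<Longrightarrow> y \<in> Y \<Longrightarrow> d' (s x) (s y) = d x y"
  shows "hausdorff_dist d' (s ` X) (s ` Y) = hausdorff_dist d X Y"
proof -
  have "(SUP x\<in>X. INF y\<in>Y. ennreal (d' (s x) (s y))) = (SUP x\<in>X. INF y\<in>Y. ennreal (d x y))"
    "(SUP y\<in>Y. INF x\<in>X. ennreal (d' (s x) (s y))) = (SUP y\<in>Y. INF x\<in>X. ennreal (d x y))"
    using assms by (auto intro!: SUP_cong INF_cong)
  then show ?thesis unfolding hausdorff_dist_def image_image by simp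
qed

definition isometric_embedding ::
    "'a set \<Rightarrow> ('a \<Rightarrow> 'a \<Rightarrow> real) \<Rightarrow> 'z set \<Rightarrow> ('z \<Rightarrow> 'z \<Rightarrow> real) \<Rightarrow> ('a \<Rightarrow> 'z) \<Rightarrow> bool" where
  "isometric_embedding X dX Z dZ h \<longleftrightarrow>
     h \<in> X \<rightarrow> Z \<and> (\<forall>x\<in>X. \<forall>y\<in>X. dZ (h x) (h y) = dX x y)"

(* HOL cannot quantify over all types inside a definition.  The common space Z is therefore taken
   with points in the disjoint sum 'a + 'b; dist_GH_le shows that this costs nothing. *)
definition dist_GH ::
    "'a set \<Rightarrow> ('a \<Rightarrow> 'a \<Rightarrow> real) \<Rightarrow> 'b set \<Rightarrow> ('b \<Rightarrow> 'b \<Rightarrow> real) \<Rightarrow> ennreal" where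
  "dist_GH X dX Y dY =
     Inf {hausdorff_dist dZ (hX ` X) (hY ` Y) |
       (Z :: ('a + 'b) set) dZ hX hY.
         Metric_space Z dZ \<and> isometric_embedding X dX Z dZ hX \<and> isometric_embedding Y dY Z dZ hY}"

lemma dist_GH_le:
  fixes Z :: "'z set" and X :: "'a set" and Y :: "'b set"
  assumes Z: "Metric_space Z dZ"
    and hX: "isometric_embedding X dX Z dZ hX" and hY: "isometric_embedding Y dY Z dZ hY"
  shows "dist_GH X dX Y dY \<le> hausdorff_dist dZ (hX ` X) (hY ` Y)"
proof -
  interpret Metric_space Z dZ by fact
  define W where "W = hX ` X \<union> hY ` Y"
  have WZ: "W \<subseteq> Z" using hX hY by (auto simp: W_def isometric_embedding_def)
  define g :: "'z \<Rightarrow> 'a + 'b" where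
    "g z = (if z \<in> hX ` X then Inl (inv_into X hX z) else Inr (inv_into Y hY z))" for z
  define k where "k p = (case p of Inl a \<Rightarrow> hX a | Inr b \<Rightarrow> hY b)" for p
  have kg: "k (g z) = z" if "z \<in> W" for z
    using that by (auto simp: g_def k_def W_def f_inv_into_f)
  define d where "d p q = dZ (k p) (k q)" for p q
  have M: "Metric_space (g ` W) d"
  proof
    show "0 \<le> d x y" for x y by (simp add: d_def)
    show "d x y = d y x" for x y by (simp add: d_def commute)
    show "(d x y = 0) = (x = y)" if "x \<in> g ` W" "y \<in> g ` W" for x y
    proof -
      from that obtain u v where uv: "u \<in> W" "v \<in> W" "x = g u" "y = g v" by blast
      then have "d x y = 0 \<longleftrightarrow> u = v" using WZ zero[of u v] by (auto simp: d_def kg subset_iff)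
      also have "\<dots> \<longleftrightarrow> x = y" using uv kg by metis
      finally show ?thesis .
    qed
    show "d x z \<le> d x y + d y z" if "x \<in> g ` W" "y \<in> g ` W" "z \<in> g ` W" for x y z
      using that WZ by (auto simp: d_def kg intro!: triangle)
  qed
  have X: "isometric_embedding X dX (g ` W) d (g \<circ> hX)"
    using hX by (auto simp: isometric_embedding_def d_def kg W_def)
  have Y: "isometric_embedding Y dY (g ` W) d (g \<circ> hY)"
    using hY by (auto simp: isometric_embedding_def d_def kg W_def)
  have "hausdorff_dist d ((g \<circ> hX) ` X) ((g \<circ> hY) ` Y) = hausdorff_dist dZ (hX ` X) (hY ` Y)"
    unfolding image_comp[symmetric] by (rule hausdorff_dist_image) (simp add: d_def kg W_def)
  then show ?thesis
    unfolding dist_GH_def using M X Y by (intro Inf_lower CollectI) metis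
qed

definition linear_isometry_into ::
    "('v::real_vector, 'm) ou_space_scheme \<Rightarrow> 'w::real_vector set \<Rightarrow> ('w \<Rightarrow> real) \<Rightarrow> ('v \<Rightarrow> 'w) \<Rightarrow> bool"
  where
  "linear_isometry_into A V N h \<longleftrightarrow>
     h \<in> ou_carrier A \<rightarrow> V \<and> linear_map_on (ou_carrier A) h \<and>
     (\<forall>a\<in>ou_carrier A. N (h a) = ou_norm A a)"

definition oq_value ::
    "('a::real_vector, 'm) qms_scheme \<Rightarrow> ('b::real_vector, 'n) qms_scheme \<Rightarrow>
     'w::real_vector set \<Rightarrow> ('w \<Rightarrow> real) \<Rightarrow> ('a \<Rightarrow> 'w) \<Rightarrow> ('b \<Rightarrow> 'w) \<Rightarrow> ennreal" where
  "oq_value A B V N hA hB =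
     max (hausdorff_dist (norm_dist V N) (hA ` lip_ball A) (hB ` lip_ball B))
         (ennreal (norm_dist V N (hA (qms_radius A *\<^sub>R ou_unit A)) (hB (qms_radius B *\<^sub>R ou_unit B))))"

(* As for dist_GH, V has to live in a fixed type: it ranges over the normed spaces whose underlying
   vector space is a subspace of 'a * 'b; dist_oq_le shows that this costs nothing. *)
definition dist_oq ::
    "('a::real_vector, 'm) qms_scheme \<Rightarrow> ('b::real_vector, 'n) qms_scheme \<Rightarrow> ennreal" where
  "dist_oq A B =
     Inf {oq_value A B V N hA hB |
       (V :: ('a \<times> 'b) set) N hA hB.
         normed_space_on V N \<and> linear_isometry_into A V N hA \<and> linear_isometry_into B V N hB}"

lemma dist_oq_le:
  fixes V :: "'w::real_vector set"
    and A :: "('a::real_vector, 'm) qms_scheme" and B :: "('b::real_vector, 'n) qms_scheme"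
  assumes A: "order_unit_space A" and B: "order_unit_space B" and V: "normed_space_on V N"
    and hA: "linear_isometry_into A V N hA" and hB: "linear_isometry_into B V N hB"
  shows "dist_oq A B \<le> oq_value A B V N hA hB"
proof -
  define SA where "SA = ou_carrier A"
  define SB where "SB = ou_carrier B"
  have sA: "subspace SA" and sB: "subspace SB" and eA: "ou_unit A \<in> SA" and eB: "ou_unit B \<in> SB"
    using A B by (auto simp: order_unit_space_def Let_def SA_def SB_def)
  have lA: "\<And>x y. x \<in> SA \<Longrightarrow> y \<in> SA \<Longrightarrow> hA (x + y) = hA x + hA y"
       "\<And>c x. x \<in> SA \<Longrightarrow> hA (c *\<^sub>R x) = c *\<^sub>R hA x" and VA: "\<And>x. x \<in> SA \<Longrightarrow> hA x \<in> V"
    and NA: "\<And>x. x \<in> SA \<Longrightarrow> N (hA x) = ou_norm A x"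
    using hA by (auto simp: linear_isometry_into_def linear_map_on_def SA_def)
  have lB: "\<And>x y. x \<in> SB \<Longrightarrow> y \<in> SB \<Longrightarrow> hB (x + y) = hB x + hB y"
       "\<And>c x. x \<in> SB \<Longrightarrow> hB (c *\<^sub>R x) = c *\<^sub>R hB x" and VB: "\<And>x. x \<in> SB \<Longrightarrow> hB x \<in> V"
    and NB: "\<And>x. x \<in> SB \<Longrightarrow> N (hB x) = ou_norm B x"
    using hB by (auto simp: linear_isometry_into_def linear_map_on_def SB_def)
  have sV: "subspace V" and snV: "seminorm_on V N" and zV: "\<And>x. x \<in> V \<Longrightarrow> N x = 0 \<Longrightarrow> x = 0"
    using V by (auto simp: normed_space_on_def)
  define P where "P = SA \<times> SB"
  have sP: "subspace P" unfolding P_def using sA sB by (rule subspace_Times)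
  define q where "q p = hA (fst p) + hB (snd p)" for p
  have q_add: "q (x + y) = q x + q y" if "x \<in> P" "y \<in> P" for x y
    using that by (auto simp: q_def P_def lA lB)
  have q_scale: "q (c *\<^sub>R x) = c *\<^sub>R q x" if "x \<in> P" for c x
    using that by (auto simp: q_def P_def lA lB scaleR_add_right)
  have qV: "q x \<in> V" if "x \<in> P" for x
    using that by (auto simp: q_def P_def intro!: subspace_add[OF sV] VA VB)
  define W where "W = q ` P"
  have sW: "subspace W"
  proof (rule subspaceI)
    show "0 \<in> W"
      using q_scale[of 0 0] subspace_0[OF sP] unfolding W_def by (metis image_eqI scaleR_zero_left)
    show "x + y \<in> W" if "x \<in> W" "y \<in> W" for x y
      using that q_add subspace_add[OF sP] unfolding W_def by (smt (verit) image_iff)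
    show "c *\<^sub>R x \<in> W" if "x \<in> W" for c x
      using that q_scale subspace_scale[OF sP] unfolding W_def by (smt (verit) image_iff)
  qed
  have WV: "W \<subseteq> V" using qV by (auto simp: W_def)
  have 0: "hA 0 = 0" "hB 0 = 0"
    using lA(2)[of 0 0] lB(2)[of 0 0] subspace_0[OF sA] subspace_0[OF sB] by auto
  have AW: "hA x \<in> W" if "x \<in> SA" for x
    using that subspace_0[OF sB] 0 unfolding W_def P_def q_def by (force intro!: image_eqI[of _ _ "(x, 0)"])
  have BW: "hB x \<in> W" if "x \<in> SB" for x
    using that subspace_0[OF sA] 0 unfolding W_def P_def q_def by (force intro!: image_eqI[of _ _ "(0, x)"])
  obtain C where C: "C \<subseteq> W" "independent C" "W \<subseteq> span C"
    using maximal_independent_subset by blast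
  have "\<exists>s. linear s \<and> (\<forall>x\<in>C. s x = inv_into P q x)"
    using linear_independent_extend[OF C(2)] by blast
  then obtain s where s: "linear s" and sC: "\<And>x. x \<in> C \<Longrightarrow> s x = inv_into P q x" by blast
  have qs_span: "s w \<in> P \<and> q (s w) = w" if "w \<in> span C" for w
    using that
  proof (induction w rule: span_induct_alt)
    case base
    show ?case using s subspace_0[OF sP] 0 by (simp add: linear_0 q_def)
  next
    case (step c x y)
    have "s x \<in> P \<and> q (s x) = x"
      using step(1) C(1) sC by (auto simp: W_def inv_into_into f_inv_into_f)
    then show ?case
      using step s q_add q_scale subspace_add[OF sP] subspace_scale[OF sP]
      by (simp add: linear_add linear_scale)
  qed
  have sP': "s w \<in> P" and qs: "q (s w) = w" if "w \<in> W" for w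
    using qs_span C(3) that by auto
  define V' where "V' = s ` W"
  define N' where "N' = N \<circ> q"
  have sV': "subspace V'" unfolding V'_def using s sW by (rule linear_subspace_image)
  have V'P: "V' \<subseteq> P" using sP' by (auto simp: V'_def)
  have V': "normed_space_on V' N'"
    unfolding normed_space_on_def
  proof (intro conjI sV' ballI impI)
    show "seminorm_on V' N'"
    proof -
      have V'P': "x \<in> P" if "x \<in> V'" for x using that V'P by blast
      show ?thesis
        using snV unfolding seminorm_on_def N'_def by (simp add: V'P' qV q_add q_scale del: split_paired_All)
    qed
    fix x assume "x \<in> V'" "N' x = 0"
    then obtain w where "w \<in> W" "x = s w" "N (q (s w)) = 0" by (auto simp: V'_def N'_def)
    then have "w = 0" using qs WV zV by auto
    then show "x = 0" using \<open>x = s w\<close> s by (simp add: linear_0)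
  qed
  have dist: "norm_dist V' N' (s x) (s y) = norm_dist V N x y" if "x \<in> W" "y \<in> W" for x y
  proof -
    have "s x - s y = s (x - y)" by (simp add: s linear_diff)
    then show ?thesis
      using that WV qs[OF subspace_diff[OF sW that]] by (auto simp: norm_dist_def V'_def N'_def)
  qed
  have A': "linear_isometry_into A V' N' (s \<circ> hA)"
    using AW lA NA qs s
    by (auto simp: linear_isometry_into_def linear_map_on_def V'_def N'_def linear_add linear_scale
        simp flip: SA_def)
  have B': "linear_isometry_into B V' N' (s \<circ> hB)"
    using BW lB NB qs s
    by (auto simp: linear_isometry_into_def linear_map_on_def V'_def N'_def linear_add linear_scale
        simp flip: SB_def)
  have DA: "lip_ball A \<subseteq> SA" and DB: "lip_ball B \<subseteq> SB"
    by (auto simp: lip_ball_def lip_ball_r_def SA_def SB_def)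
  have "hausdorff_dist (norm_dist V' N') ((s \<circ> hA) ` lip_ball A) ((s \<circ> hB) ` lip_ball B) =
        hausdorff_dist (norm_dist V N) (hA ` lip_ball A) (hB ` lip_ball B)"
    unfolding image_comp[symmetric]
    by (rule hausdorff_dist_image) (use DA DB AW BW in \<open>auto intro!: dist\<close>)
  then have "oq_value A B V' N' (s \<circ> hA) (s \<circ> hB) = oq_value A B V N hA hB"
    using eA eB by (simp add: oq_value_def dist AW BW subspace_scale[OF sA] subspace_scale[OF sB])
  then show ?thesis
    unfolding dist_oq_def using V' A' B' by (intro Inf_lower CollectI) metis
qed

definition cont_field_banach ::
    "('t::topological_space \<Rightarrow> 'v::real_vector set) \<Rightarrow> ('t \<Rightarrow> 'v \<Rightarrow> real) \<Rightarrow> ('t \<Rightarrow> 'v) set \<Rightarrow> bool" where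
  "cont_field_banach E N \<Gamma> \<longleftrightarrow>
     (\<forall>t. banach_on (E t) (N t)) \<and>
     \<Gamma> \<subseteq> Pi UNIV E \<and>
     (\<lambda>t. 0) \<in> \<Gamma> \<and> (\<forall>f\<in>\<Gamma>. \<forall>g\<in>\<Gamma>. (\<lambda>t. f t + g t) \<in> \<Gamma>) \<and> (\<forall>c. \<forall>f\<in>\<Gamma>. (\<lambda>t. c *\<^sub>R f t) \<in> \<Gamma>) \<and>
     (\<forall>t. dense_for (norm_dist (E t) (N t)) ((\<lambda>f. f t) ` \<Gamma>) (E t)) \<and>
     (\<forall>f\<in>\<Gamma>. continuous_on UNIV (\<lambda>t. N t (f t))) \<and>
     (\<forall>f \<in> Pi UNIV E.
        (\<forall>s. \<forall>\<epsilon>>0. \<exists>g\<in>\<Gamma>. \<forall>\<^sub>F t in nhds s. N t (f t - g t) \<le> \<epsilon>) \<longrightarrow> f \<in> \<Gamma>)"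

definition cont_field_ou ::
    "('t::topological_space \<Rightarrow> ('v::real_vector, 'm) ou_space_scheme) \<Rightarrow> ('t \<Rightarrow> 'v) set \<Rightarrow> bool" where
  "cont_field_ou E \<Gamma> \<longleftrightarrow>
     (\<forall>t. order_unit_space (E t)) \<and>
     cont_field_banach (\<lambda>t. ou_carrier (E t)) (\<lambda>t. ou_norm (E t)) \<Gamma> \<and>
     (\<lambda>t. ou_unit (E t)) \<in> \<Gamma>"

(* E is the norm completion of A, with A regarded as a subspace of it.  The order of E is then
   determined by that of A: the positive cone of E is the closure of that of A. *)
definition ou_completion ::
    "('v::real_vector, 'm) ou_space_scheme \<Rightarrow> ('v, 'n) ou_space_scheme \<Rightarrow> bool" where
  "ou_completion A E \<longleftrightarrow>
     order_unit_space A \<and> order_unit_space E \<and>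
     banach_on (ou_carrier E) (ou_norm E) \<and>
     ou_unit A = ou_unit E \<and>
     (\<forall>x\<in>ou_carrier A. \<forall>y\<in>ou_carrier A. ou_le A x y \<longleftrightarrow> ou_le E x y) \<and>
     dense_for (ou_dist E) (ou_carrier A) (ou_carrier E)"

definition lip_ext :: "('v::real_vector, 'm) qms_scheme \<Rightarrow> 'v \<Rightarrow> ennreal" where
  "lip_ext A a = (if a \<in> ou_carrier A then ennreal (lip A a) else \<infinity>)"

definition upper_semicont_at :: "('t::topological_space \<Rightarrow> ennreal) \<Rightarrow> 't \<Rightarrow> bool" where
  "upper_semicont_at g s \<longleftrightarrow> (\<forall>c>g s. \<forall>\<^sub>F t in nhds s. g t < c)"

definition lip_sections ::
    "('t::topological_space \<Rightarrow> ('v::real_vector, 'm) qms_scheme) \<Rightarrow> ('t \<Rightarrow> 'v) set \<Rightarrow> 't \<Rightarrow> ('t \<Rightarrow> 'v) set"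
  where
  "lip_sections A \<Gamma> s = {f \<in> \<Gamma>. upper_semicont_at (\<lambda>t. lip_ext (A t) (f t)) s}"

definition cont_field_cqms ::
    "('t::topological_space \<Rightarrow> ('v::real_vector, 'm) qms_scheme) \<Rightarrow>
     ('t \<Rightarrow> ('v, 'n) ou_space_scheme) \<Rightarrow> ('t \<Rightarrow> 'v) set \<Rightarrow> bool" where
  "cont_field_cqms A E \<Gamma> \<longleftrightarrow>
     (\<forall>t. compact_qms (A t)) \<and>
     (\<forall>t. ou_completion (A t) (E t)) \<and>
     cont_field_ou E \<Gamma> \<and>
     (\<forall>t. \<forall>a\<in>ou_carrier (A t). \<forall>\<epsilon>>0. \<exists>f\<in>lip_sections A \<Gamma> t.
        ou_norm (E t) (f t - a) < \<epsilon> \<and> lip_ext (A t) (f t) < ennreal (lip (A t) a + \<epsilon>))"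

end

theory Submission
  imports Defs
begin

text \<open>
  Write \<D>(t) for the Lipschitz unit ball of radius r(t) in the fibre at t, and s for the base point.
  Two facts make the three conditions comparable. First, the ball cannot collapse near s: every
  element of \<D>(s) extends, up to a small error, to a continuous section whose values lie in \<D>(t)
  for all t near s. Secondly, on a fixed finite family of sections the fibre norms converge
  uniformly, relative to the sum of the absolute values of the coefficients. What the three
  conditions add is that \<D>(t) does not grow.

  The extension property (lip_ball_section) is the place where the field axiom about the Lip-norms
  enters. The axiom gives a section with Lip-norm only slightly above 1; multiplying it by a number
  slightly below 1 repairs the Lip-norm and also makes the norm at s strictly smaller than r(s),
  so it suffices that the radius is lower semicontinuous (radius_lower_semicontinuous). Twice the
  radius is the supremum of the oscillations of elements with Lip-norm at most 1 over the state
  space. The oscillation of x equals the norm of x + K e plus the norm of K e - x minus 2 K for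
  every K at least the norm of x, and in this form it visibly depends continuously on t along a
  section. The formula rests on the existence of states that attain the maximal value of an
  element, a case of the Hahn-Banach theorem.

  From (i) to (ii): a linear isometric embedding of two order-unit spaces is in particular an
  isometric embedding of their Lipschitz balls.

  From (ii) to (iii) (cover_of_GH_convergence): the ball \<D>(s) is totally bounded, because the state
  space is compact for the metric given by the Lip-norm. So there is a largest number n of points of
  \<D>(s) with mutual distances greater than \<epsilon>/4, and a finite set of distances leaves a gap
  above \<epsilon>/4. Extend n such points to sections in the balls \<D>(t). If some point of \<D>(t) were far
  from all their values, there would be n + 1 well separated points in \<D>(t), and an almost isometric
  map from \<D>(t) to \<D>(s), which exists for small Gromov-Hausdorff distance, would carry them to n + 1
  separated points of \<D>(s).

  From (iii) to (i) (dist_oq_small_of_cover): put on the product of the fibres at t and s the largest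
  norm that restricts to the given norms and for which the vectors (h(t), -h(s)) have norm at most
  \<delta>, where h runs through finitely many sections, among them the unit section, those that
  provide the cover, and their approximations by sections in the balls. That it restricts to the
  given norms follows from the uniform convergence on finite families (amalgamated_norm,
  combination_norms_converge). The
  multiples of the unit are controlled by the cover too: r(t) times the unit lies in \<D>(t) and has
  norm r(t), whence r(t) is at most r(s) up to a small error; the other inequality is the lower
  semicontinuity of the radius.
\<close>

section \<open>Order-unit spaces and their norm\<close>

locale order_unit =
  fixes A :: "('v::real_vector, 'm) ou_space_scheme"
  assumes ou: "order_unit_space A"
begin

abbreviation carrier_set :: "'v set" ("S") where "S \<equiv> ou_carrier A"
abbreviation below :: "'v \<Rightarrow> 'v \<Rightarrow> bool" (infix "\<sqsubseteq>" 50) where "x \<sqsubseteq> y \<equiv> ou_le A x y"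
abbreviation unit_elt :: 'v ("e") where "e \<equiv> ou_unit A"
abbreviation unit_norm :: "'v \<Rightarrow> real" ("\<nu>") where "\<nu> \<equiv> ou_norm A"

lemma subspace_S: "subspace S"
  and le_refl: "x \<in> S \<Longrightarrow> x \<sqsubseteq> x"
  and le_antisym: "x \<in> S \<Longrightarrow> y \<in> S \<Longrightarrow> x \<sqsubseteq> y \<Longrightarrow> y \<sqsubseteq> x \<Longrightarrow> x = y"
  and le_trans: "x \<in> S \<Longrightarrow> y \<in> S \<Longrightarrow> z \<in> S \<Longrightarrow> x \<sqsubseteq> y \<Longrightarrow> y \<sqsubseteq> z \<Longrightarrow> x \<sqsubseteq> z"
  and le_add: "x \<in> S \<Longrightarrow> y \<in> S \<Longrightarrow> z \<in> S \<Longrightarrow> x \<sqsubseteq> y \<Longrightarrow> x + z \<sqsubseteq> y + z"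
  and le_scale: "x \<in> S \<Longrightarrow> y \<in> S \<Longrightarrow> 0 \<le> c \<Longrightarrow> x \<sqsubseteq> y \<Longrightarrow> c *\<^sub>R x \<sqsubseteq> c *\<^sub>R y"
  and e_in: "e \<in> S" and e_nonzero: "e \<noteq> 0" and e_pos: "0 \<sqsubseteq> e"
  and unit_dominates: "x \<in> S \<Longrightarrow> \<exists>r. x \<sqsubseteq> r *\<^sub>R e"
  and archimedean: "x \<in> S \<Longrightarrow> (\<And>r. r > 0 \<Longrightarrow> x \<sqsubseteq> r *\<^sub>R e) \<Longrightarrow> x \<sqsubseteq> 0"
proof -
  note * = ou[unfolded order_unit_space_def Let_def reflp_on_def antisymp_on_def transp_on_def]
  show "subspace S" "e \<in> S" "e \<noteq> 0" "0 \<sqsubseteq> e" using * by simp_all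
  show "x \<in> S \<Longrightarrow> x \<sqsubseteq> x" using * by simp
  show "x \<in> S \<Longrightarrow> y \<in> S \<Longrightarrow> x \<sqsubseteq> y \<Longrightarrow> y \<sqsubseteq> x \<Longrightarrow> x = y"
    using *[THEN conjunct2, THEN conjunct2, THEN conjunct1] by simp
  show "x \<in> S \<Longrightarrow> y \<in> S \<Longrightarrow> z \<in> S \<Longrightarrow> x \<sqsubseteq> y \<Longrightarrow> y \<sqsubseteq> z \<Longrightarrow> x \<sqsubseteq> z"
    using *[THEN conjunct2, THEN conjunct2, THEN conjunct2, THEN conjunct1, rule_format, of x y z]
    by simp
  show "x \<in> S \<Longrightarrow> y \<in> S \<Longrightarrow> z \<in> S \<Longrightarrow> x \<sqsubseteq> y \<Longrightarrow> x + z \<sqsubseteq> y + z"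
    using *[THEN conjunct2, THEN conjunct2, THEN conjunct2, THEN conjunct2, THEN conjunct1] by simp
  show "x \<in> S \<Longrightarrow> y \<in> S \<Longrightarrow> 0 \<le> c \<Longrightarrow> x \<sqsubseteq> y \<Longrightarrow> c *\<^sub>R x \<sqsubseteq> c *\<^sub>R y"
    using *[THEN conjunct2, THEN conjunct2, THEN conjunct2, THEN conjunct2, THEN conjunct2,
        THEN conjunct1] by simp
  show "x \<in> S \<Longrightarrow> \<exists>r. x \<sqsubseteq> r *\<^sub>R e"
    "x \<in> S \<Longrightarrow> (\<And>r. r > 0 \<Longrightarrow> x \<sqsubseteq> r *\<^sub>R e) \<Longrightarrow> x \<sqsubseteq> 0"
    using *[THEN conjunct2, THEN conjunct2, THEN conjunct2, THEN conjunct2, THEN conjunct2,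
        THEN conjunct2] by simp_all
qed

lemma S_simps [simp]:
  "x \<in> S \<Longrightarrow> y \<in> S \<Longrightarrow> x + y \<in> S" "x \<in> S \<Longrightarrow> y \<in> S \<Longrightarrow> x - y \<in> S"
  "x \<in> S \<Longrightarrow> c *\<^sub>R x \<in> S" "x \<in> S \<Longrightarrow> - x \<in> S" "0 \<in> S" "e \<in> S"
  using subspace_S e_in
  by (auto simp: subspace_add subspace_diff subspace_scale subspace_0 subspace_neg)

lemma le_add2:
  assumes "x \<in> S" "y \<in> S" "u \<in> S" "v \<in> S" "x \<sqsubseteq> y" "u \<sqsubseteq> v"
  shows "x + u \<sqsubseteq> y + v"
proof (rule le_trans)
  show "x + u \<sqsubseteq> y + u" using assms by (intro le_add) auto
  show "y + u \<sqsubseteq> y + v" using le_add[of u v y] assms by (simp add: add.commute)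
qed (use assms in auto)

lemma le_neg:
  assumes "x \<in> S" "y \<in> S" "x \<sqsubseteq> y"
  shows "- y \<sqsubseteq> - x"
  using le_add[of x y "- x - y"] assms by simp

text \<open>If the multiples of the unit were not ordered like their coefficients, the unit would be
  negative as well as positive, and antisymmetry would make it 0.\<close>

lemma unit_le_iff: "r *\<^sub>R e \<sqsubseteq> s *\<^sub>R e \<longleftrightarrow> r \<le> s"
proof
  assume "r \<le> s"
  then have "0 \<sqsubseteq> (s - r) *\<^sub>R e" using le_scale[of 0 e "s - r"] e_pos by simp
  then show "r *\<^sub>R e \<sqsubseteq> s *\<^sub>R e"
    using le_add[of 0 "(s - r) *\<^sub>R e" "r *\<^sub>R e"] by (simp add: algebra_simps)
next
  assume le: "r *\<^sub>R e \<sqsubseteq> s *\<^sub>R e"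
  show "r \<le> s"
  proof (rule ccontr)
    assume "\<not> r \<le> s"
    have "(r - s) *\<^sub>R e \<sqsubseteq> 0"
      using le_add[of "r *\<^sub>R e" "s *\<^sub>R e" "- (s *\<^sub>R e)"] le by (simp add: algebra_simps)
    then have "e \<sqsubseteq> 0"
      using le_scale[of "(r - s) *\<^sub>R e" 0 "inverse (r - s)"] \<open>\<not> r \<le> s\<close> by simp
    then show False using le_antisym[of e 0] e_pos e_nonzero by simp
  qed
qed

lemma le_unit_mono: "x \<in> S \<Longrightarrow> x \<sqsubseteq> r *\<^sub>R e \<Longrightarrow> r \<le> s \<Longrightarrow> x \<sqsubseteq> s *\<^sub>R e"
  using le_trans[of x "r *\<^sub>R e" "s *\<^sub>R e"] by (simp add: unit_le_iff)

lemma le_unit_archimedean: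
  assumes "x \<in> S" and "\<And>r. r > s \<Longrightarrow> x \<sqsubseteq> r *\<^sub>R e"
  shows "x \<sqsubseteq> s *\<^sub>R e"
proof -
  have "x - s *\<^sub>R e \<sqsubseteq> 0"
  proof (rule archimedean)
    fix r :: real assume "r > 0"
    then show "x - s *\<^sub>R e \<sqsubseteq> r *\<^sub>R e"
      using le_add[of x "(s + r) *\<^sub>R e" "- (s *\<^sub>R e)"] assms(1) assms(2)[of "s + r"]
      by (simp add: algebra_simps)
  qed (use assms in auto)
  then show ?thesis using le_add[of "x - s *\<^sub>R e" 0 "s *\<^sub>R e"] assms by simp
qed

lemma norm_set_bounds:
  assumes "x \<in> S"
  shows "\<exists>r. - (r *\<^sub>R e) \<sqsubseteq> x \<and> x \<sqsubseteq> r *\<^sub>R e"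
    and "- (r *\<^sub>R e) \<sqsubseteq> x \<Longrightarrow> x \<sqsubseteq> r *\<^sub>R e \<Longrightarrow> 0 \<le> r"
proof -
  obtain r1 r2 where r: "x \<sqsubseteq> r1 *\<^sub>R e" "- x \<sqsubseteq> r2 *\<^sub>R e"
    using unit_dominates[of x] unit_dominates[of "- x"] assms by auto
  define r where "r = max r1 r2"
  have "x \<sqsubseteq> r *\<^sub>R e" "- x \<sqsubseteq> r *\<^sub>R e"
    using r assms le_unit_mono[of x r1 r] le_unit_mono[of "- x" r2 r] by (auto simp: r_def)
  then show "\<exists>r. - (r *\<^sub>R e) \<sqsubseteq> x \<and> x \<sqsubseteq> r *\<^sub>R e"
    using le_neg[of "- x" "r *\<^sub>R e"] assms by auto
next
  assume "- (r *\<^sub>R e) \<sqsubseteq> x" "x \<sqsubseteq> r *\<^sub>R e"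
  then have "- (r *\<^sub>R e) \<sqsubseteq> r *\<^sub>R e"
    using assms le_trans[of "- (r *\<^sub>R e)" x "r *\<^sub>R e"] by simp
  then show "0 \<le> r" using unit_le_iff[of "- r" r] by simp
qed

text \<open>Because the space is archimedean, the infimum that defines the norm is attained.\<close>

lemma norm_bounds:
  assumes x: "x \<in> S"
  shows "x \<sqsubseteq> \<nu> x *\<^sub>R e" "- (\<nu> x *\<^sub>R e) \<sqsubseteq> x"
proof -
  let ?R = "{r. - (r *\<^sub>R e) \<sqsubseteq> x \<and> x \<sqsubseteq> r *\<^sub>R e}"
  have up: "x \<sqsubseteq> r *\<^sub>R e \<and> - x \<sqsubseteq> r *\<^sub>R e" if "r > \<nu> x" for r
  proof -
    have "?R \<noteq> {}" using norm_set_bounds(1)[OF x] by blast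
    from cInf_lessD[OF this that[unfolded ou_norm_def]]
    obtain r' where r': "r' \<in> ?R" "r' < r" by blast
    then have "- x \<sqsubseteq> r' *\<^sub>R e" using le_neg[of "- (r' *\<^sub>R e)" x] x by simp
    moreover have "x \<sqsubseteq> r' *\<^sub>R e" "r' \<le> r" using r' by auto
    ultimately show ?thesis using le_unit_mono S_simps(4) x by blast
  qed
  show "x \<sqsubseteq> \<nu> x *\<^sub>R e" by (rule le_unit_archimedean[OF x]) (simp add: up)
  have "- x \<sqsubseteq> \<nu> x *\<^sub>R e" by (rule le_unit_archimedean[OF S_simps(4)[OF x]]) (simp add: up)
  then show "- (\<nu> x *\<^sub>R e) \<sqsubseteq> x" using le_neg[of "- x" "\<nu> x *\<^sub>R e"] x by simp
qed

lemma norm_le_iff: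
  assumes "x \<in> S"
  shows "\<nu> x \<le> r \<longleftrightarrow> x \<sqsubseteq> r *\<^sub>R e \<and> - x \<sqsubseteq> r *\<^sub>R e"
proof
  assume "\<nu> x \<le> r"
  moreover have "- x \<sqsubseteq> \<nu> x *\<^sub>R e"
    using norm_bounds[OF assms] le_neg[of "- (\<nu> x *\<^sub>R e)" x] assms by simp
  ultimately show "x \<sqsubseteq> r *\<^sub>R e \<and> - x \<sqsubseteq> r *\<^sub>R e"
    using norm_bounds[OF assms] assms le_unit_mono[of x "\<nu> x" r] le_unit_mono[of "- x" "\<nu> x" r]
    by simp
next
  assume *: "x \<sqsubseteq> r *\<^sub>R e \<and> - x \<sqsubseteq> r *\<^sub>R e"
  then have "- (r *\<^sub>R e) \<sqsubseteq> x" using le_neg[of "- x" "r *\<^sub>R e"] assms by simp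
  with * show "\<nu> x \<le> r"
    unfolding ou_norm_def
    using norm_set_bounds(2)[OF assms] by (intro cInf_lower bdd_belowI[of _ 0]) auto
qed

lemma norm_nonneg: "x \<in> S \<Longrightarrow> 0 \<le> \<nu> x"
  using norm_set_bounds(2) norm_bounds by blast

lemma norm_e: "\<nu> e = 1"
proof (rule antisym)
  show "\<nu> e \<le> 1"
    using norm_le_iff[of e 1] unit_le_iff[of "-1" 1] by (simp add: le_refl)
  show "1 \<le> \<nu> e" using norm_bounds(1)[of e] unit_le_iff[of 1 "\<nu> e"] by simp
qed

lemma norm_add: "x \<in> S \<Longrightarrow> y \<in> S \<Longrightarrow> \<nu> (x + y) \<le> \<nu> x + \<nu> y"
  using norm_le_iff[of x "\<nu> x"] norm_le_iff[of y "\<nu> y"]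
    le_add2[of x "\<nu> x *\<^sub>R e" y "\<nu> y *\<^sub>R e"] le_add2[of "- x" "\<nu> x *\<^sub>R e" "- y" "\<nu> y *\<^sub>R e"]
  by (simp add: norm_le_iff algebra_simps)

lemma norm_minus: "x \<in> S \<Longrightarrow> \<nu> (- x) = \<nu> x"
  using norm_le_iff[of x] norm_le_iff[of "- x"] by (metis S_simps(4) antisym add.inverse_inverse order_refl)

lemma norm_scale:
  assumes "x \<in> S"
  shows "\<nu> (c *\<^sub>R x) = \<bar>c\<bar> * \<nu> x"
proof -
  have le: "\<nu> (c *\<^sub>R x) \<le> c * \<nu> x" if "0 \<le> c" "x \<in> S" for c x
    using norm_le_iff[of x "\<nu> x"] le_scale[of x "\<nu> x *\<^sub>R e" c] le_scale[of "- x" "\<nu> x *\<^sub>R e" c] that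
    by (simp add: norm_le_iff)
  have eq: "\<nu> (c *\<^sub>R x) = c * \<nu> x" if "0 < c" "x \<in> S" for c x
  proof (rule antisym)
    show "\<nu> (c *\<^sub>R x) \<le> c * \<nu> x" using that by (simp add: le)
    have "\<nu> x \<le> inverse c * \<nu> (c *\<^sub>R x)"
      using le[of "inverse c" "c *\<^sub>R x"] that by simp
    then show "c * \<nu> x \<le> \<nu> (c *\<^sub>R x)" using that by (simp add: field_simps)
  qed
  have z: "\<nu> 0 = 0"
    using le[of 0 x] norm_nonneg[of 0] assms by simp
  consider "c > 0" | "c = 0" | "c < 0" by linarith
  then show ?thesis
  proof cases
    case 3
    then show ?thesis using eq[of "- c" x] norm_minus[of "c *\<^sub>R x"] assms by simp
  qed (use eq z assms in auto)
qed

lemma norm_eq_0: "x \<in> S \<Longrightarrow> \<nu> x = 0 \<Longrightarrow> x = 0"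
  using norm_bounds[of x] le_antisym[of x 0] by simp

lemma normed_space: "normed_space_on S \<nu>"
  unfolding normed_space_on_def seminorm_on_def
  using subspace_S norm_nonneg norm_add norm_scale norm_eq_0 by blast

end

section \<open>The Hahn-Banach theorem\<close>

definition sublinear :: "('v::real_vector \<Rightarrow> real) \<Rightarrow> bool" where
  "sublinear p \<longleftrightarrow> (\<forall>x y. p (x + y) \<le> p x + p y) \<and> (\<forall>c\<ge>0. \<forall>x. p (c *\<^sub>R x) = c * p x)"

lemma sublinear_D:
  assumes "sublinear p"
  shows "p (x + y) \<le> p x + p y" "0 \<le> c \<Longrightarrow> p (c *\<^sub>R x) = c * p x" "p 0 = 0" "- p (- x) \<le> p x"
proof -
  show a: "p (x + y) \<le> p x + p y" and "0 \<le> c \<Longrightarrow> p (c *\<^sub>R x) = c * p x" for x y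
    using assms by (auto simp: sublinear_def)
  show z: "p 0 = 0" using assms unfolding sublinear_def by (metis mult_zero_left order_refl scaleR_zero_left)
  show "- p (- x) \<le> p x" using a[of x "- x"] z by simp
qed

text \<open>This is the standard way to make a sublinear functional smaller: the result is the largest
  sublinear functional below q that is at most - q y at - y. A functional that cannot be made
  smaller in this way is therefore additive in the direction of y.\<close>

definition tilt :: "('v::real_vector \<Rightarrow> real) \<Rightarrow> 'v \<Rightarrow> 'v \<Rightarrow> real" where
  "tilt q y x = (INF t\<in>{0..}. q (x + t *\<^sub>R y) - t * q y)"

lemma tilt_props:
  assumes q: "sublinear q"
  shows "sublinear (tilt q y)" "tilt q y x \<le> q x" "tilt q y (- y) \<le> - q y"
    "tilt q y x \<le> q (x + y) - q y"
proof -
  note D = sublinear_D[OF q]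
  have bdd: "bdd_below ((\<lambda>t. q (x + t *\<^sub>R y) - t * q y) ` {0..})" for x
  proof (rule bdd_belowI2)
    fix t :: real assume "t \<in> {0..}"
    then have "t * q y \<le> q (x + t *\<^sub>R y) + q (- x)"
      using D(1)[of "x + t *\<^sub>R y" "- x"] D(2)[of t y] by simp
    then show "- q (- x) \<le> q (x + t *\<^sub>R y) - t * q y" by simp
  qed
  have low: "tilt q y x \<le> q (x + t *\<^sub>R y) - t * q y" if "t \<ge> 0" for x t
    unfolding tilt_def using that by (intro cINF_lower bdd) auto
  have great: "m \<le> tilt q y x" if "\<And>t. t \<ge> 0 \<Longrightarrow> m \<le> q (x + t *\<^sub>R y) - t * q y" for m x
    unfolding tilt_def using that by (intro cINF_greatest) auto
  show "tilt q y x \<le> q x" using low[of 0 x] by simp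
  show "tilt q y x \<le> q (x + y) - q y" using low[of 1 x] by simp
  show "tilt q y (- y) \<le> - q y" using low[of 1 "- y"] D(3) by simp
  show "sublinear (tilt q y)"
    unfolding sublinear_def
  proof (intro conjI allI impI)
    fix u v
    have step: "tilt q y (u + v) - (q (v + s *\<^sub>R y) - s * q y) \<le> q (u + t *\<^sub>R y) - t * q y"
      if "s \<ge> 0" "t \<ge> 0" for s t
      using low[of "t + s" "u + v"] D(1)[of "u + t *\<^sub>R y" "v + s *\<^sub>R y"] that
      by (simp add: algebra_simps)
    have "tilt q y (u + v) - tilt q y u \<le> q (v + s *\<^sub>R y) - s * q y" if "s \<ge> 0" for s
      using great[of "tilt q y (u + v) - (q (v + s *\<^sub>R y) - s * q y)" u] step that by force
    then show "tilt q y (u + v) \<le> tilt q y u + tilt q y v"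
      using great[of "tilt q y (u + v) - tilt q y u" v] by force
  next
    fix c :: real and u assume "0 \<le> c"
    have le: "tilt q y (c *\<^sub>R u) \<le> c * tilt q y u" if "c > 0" for c u
    proof -
      have "tilt q y (c *\<^sub>R u) / c \<le> q (u + t *\<^sub>R y) - t * q y" if "t \<ge> 0" for t
        using low[of "c * t" "c *\<^sub>R u"] D(2)[of c "u + t *\<^sub>R y"] \<open>c > 0\<close> that
        by (simp add: field_simps scaleR_add_right)
      from great[OF this] show ?thesis using that by (simp add: field_simps)
    qed
    show "tilt q y (c *\<^sub>R u) = c * tilt q y u"
    proof (cases "c = 0")
      case True
      have "tilt q y 0 = 0"
        using low[of 0 0] great[of 0 0] D by (intro antisym) auto
      then show ?thesis using True by simp
    next
      case False
      with \<open>0 \<le> c\<close> have "c > 0" by simp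
      show ?thesis
        using le[OF \<open>c > 0\<close>, of u] le[of "inverse c" "c *\<^sub>R u"] \<open>c > 0\<close>
        by (intro antisym) (auto simp: field_simps)
    qed
  qed
qed

text \<open>Among the sublinear functionals below p, ordered pointwise, Zorn's lemma provides a minimal one:
  the pointwise infimum of a chain is finite because every member of it is at least - p (- x) at x.
  A minimal one equals all of its tilts, and this says that it is additive.\<close>

lemma exists_linear_below_sublinear:
  fixes p :: "'v::real_vector \<Rightarrow> real"
  assumes p: "sublinear p"
  shows "\<exists>f. linear f \<and> (\<forall>x. f x \<le> p x)"
proof -
  define Q where "Q = {q. sublinear q \<and> q \<le> p}"

  have "\<exists>m\<in>Q. \<forall>q\<in>Q. q \<le> m \<longrightarrow> q = m"
  proof (rule predicate_Zorn)
    show "partial_order_on Q (relation_of (\<lambda>q r. r \<le> q) Q)"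
      by (rule partial_order_on_relation_ofI) auto
  next
    fix C assume "C \<in> Chains (relation_of (\<lambda>q r. r \<le> q) Q)"
    then have CQ: "C \<subseteq> Q" and ch: "\<And>q r. q \<in> C \<Longrightarrow> r \<in> C \<Longrightarrow> q \<le> r \<or> r \<le> q"
      by (auto simp: Chains_def relation_of_def)
    show "\<exists>u\<in>Q. \<forall>a\<in>C. u \<le> a"
    proof (cases "C = {}")
      case True
      have "p \<in> Q" using p by (simp add: Q_def)
      with True show ?thesis by blast
    next
      case False
      define u where "u x = (INF q\<in>C. q x)" for x
      have bdd: "bdd_below ((\<lambda>q. q x) ` C)" for x
      proof (rule bdd_belowI2)
        fix q assume "q \<in> C"
        then have q: "sublinear q" "q (- x) \<le> p (- x)" using CQ by (auto simp: Q_def le_fun_def)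
        then show "- p (- x) \<le> q x" using sublinear_D(4)[OF q(1), of x] by linarith
      qed
      have low: "u x \<le> q x" if "q \<in> C" for q x
        unfolding u_def by (rule cINF_lower[OF bdd that])
      have great: "m \<le> u x" if "\<And>q. q \<in> C \<Longrightarrow> m \<le> q x" for m x
        unfolding u_def using False that by (intro cINF_greatest) auto
      have sC: "sublinear q" "q \<le> p" if "q \<in> C" for q using that CQ by (auto simp: Q_def)
      have "sublinear u"
        unfolding sublinear_def
      proof (intro conjI allI impI)
        fix x y
        \<comment> \<open>The members q and r are used at different points; the smaller of them serves at both.\<close>
        have "u (x + y) - r y \<le> q x" if "q \<in> C" "r \<in> C" for q r
        proof -
          obtain m where m: "m \<in> C" "m \<le> q" "m \<le> r" using ch[of q r] \<open>q \<in> C\<close> \<open>r \<in> C\<close> by blast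
          then show ?thesis
            using low[OF m(1), of "x + y"] sublinear_D(1)[OF sC(1)[OF m(1)], of x y]
            by (smt (verit) le_fun_def)
        qed
        then have "u (x + y) - r y \<le> u x" if "r \<in> C" for r using great that by blast
        then have "u (x + y) - u x \<le> u y" by (intro great) (smt (verit))
        then show "u (x + y) \<le> u x + u y" by simp
      next
        fix c :: real and x assume "0 \<le> c"
        have le: "u (c *\<^sub>R x) \<le> c * u x" if "c > 0" for c x
        proof -
          have "u (c *\<^sub>R x) / c \<le> q x" if "q \<in> C" for q
            using low[OF that, of "c *\<^sub>R x"] sublinear_D(2)[OF sC(1)[OF that], of c x] \<open>c > 0\<close>
            by (simp add: field_simps)
          from great[OF this] show ?thesis using that by (simp add: field_simps)
        qed
        show "u (c *\<^sub>R x) = c * u x"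
        proof (cases "c = 0")
          case True
          have "u 0 = (INF q\<in>C. 0)"
            unfolding u_def using sublinear_D(3)[OF sC(1)] by (intro INF_cong) auto
          then show ?thesis using True False by simp
        next
          case nz: False
          with \<open>0 \<le> c\<close> have "c > 0" by simp
          show ?thesis
            using le[OF \<open>c > 0\<close>, of x] le[of "inverse c" "c *\<^sub>R x"] \<open>c > 0\<close>
            by (intro antisym) (auto simp: field_simps)
        qed
      qed
      moreover have "u \<le> p"
        using False low sC(2) by (metis ex_in_conv le_fun_def order_trans)
      ultimately show ?thesis using low by (auto simp: Q_def le_fun_def)
    qed
  qed
  then obtain q where q: "sublinear q" "q \<le> p" and min: "\<And>r. sublinear r \<Longrightarrow> r \<le> q \<Longrightarrow> r = q"
    unfolding Q_def using order_trans by blast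
  note D = sublinear_D[OF q(1)]
  have add: "q (x + y) = q x + q y" for x y
  proof -
    have "tilt q y = q" using tilt_props[OF q(1)] by (intro min) (auto simp: le_fun_def)
    then have "q x \<le> q (x + y) - q y" using tilt_props(4)[OF q(1), of y x] by simp
    then show ?thesis using D(1)[of x y] by simp
  qed
  have neg: "q (- x) = - q x" for x using add[of x "- x"] D(3) by simp
  have "q (c *\<^sub>R x) = c * q x" for c x
    using D(2)[of c x] D(2)[of "- c" x] neg[of "c *\<^sub>R x"] by (cases "c \<ge> 0") auto
  then have "linear q" using add by (intro linearI) auto
  then show ?thesis using q(2) by (auto simp: le_fun_def)
qed

section \<open>States\<close>

context order_unit
begin

lemma statesI:
  assumes "\<mu> \<in> extensional S" "linear_map_on S \<mu>" "\<mu> e = 1" "\<And>x. x \<in> S \<Longrightarrow> \<bar>\<mu> x\<bar> \<le> \<nu> x"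
  shows "\<mu> \<in> states A"
proof -
  have "dual_norm A \<mu> = 1"
  proof (rule antisym)
    show "dual_norm A \<mu> \<le> 1"
      unfolding dual_norm_def
    proof (rule SUP_least)
      fix x assume "x \<in> {a \<in> S. \<nu> a \<le> 1}"
      then have "\<bar>\<mu> x\<bar> \<le> 1" using assms(4)[of x] by simp
      then show "ennreal \<bar>\<mu> x\<bar> \<le> 1" by (simp add: ennreal_le_1)
    qed
    show "1 \<le> dual_norm A \<mu>"
      unfolding dual_norm_def using assms(3) norm_e by (intro SUP_upper2[of e]) auto
  qed
  then show ?thesis using assms by (simp add: states_def)
qed

lemma states_D:
  assumes "\<mu> \<in> states A"
  shows "\<mu> \<in> extensional S" "linear_map_on S \<mu>" "\<mu> e = 1"
    "x \<in> S \<Longrightarrow> y \<in> S \<Longrightarrow> \<mu> (x + y) = \<mu> x + \<mu> y"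
    "x \<in> S \<Longrightarrow> y \<in> S \<Longrightarrow> \<mu> (x - y) = \<mu> x - \<mu> y"
    "x \<in> S \<Longrightarrow> \<mu> (c *\<^sub>R x) = c * \<mu> x"
    "x \<in> S \<Longrightarrow> \<bar>\<mu> x\<bar> \<le> \<nu> x"
proof -
  show *: "\<mu> \<in> extensional S" "linear_map_on S \<mu>" "\<mu> e = 1"
    using assms by (auto simp: states_def)
  show add: "x \<in> S \<Longrightarrow> y \<in> S \<Longrightarrow> \<mu> (x + y) = \<mu> x + \<mu> y"
    and sc: "x \<in> S \<Longrightarrow> \<mu> (c *\<^sub>R x) = c * \<mu> x" for x y c
    using *(2) by (auto simp: linear_map_on_def)
  show "x \<in> S \<Longrightarrow> y \<in> S \<Longrightarrow> \<mu> (x - y) = \<mu> x - \<mu> y"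
    using add[of x "(-1) *\<^sub>R y"] sc[of y "-1"] by simp
  assume x: "x \<in> S"
  have bound: "\<bar>\<mu> z\<bar> \<le> 1" if "z \<in> S" "\<nu> z \<le> 1" for z
  proof -
    have "ennreal \<bar>\<mu> z\<bar> \<le> dual_norm A \<mu>"
      unfolding dual_norm_def using that by (intro SUP_upper) auto
    then show ?thesis using assms by (simp add: states_def ennreal_le_1)
  qed
  show "\<bar>\<mu> x\<bar> \<le> \<nu> x"
  proof (cases "x = 0")
    case True
    then show ?thesis using sc[of 0 0] norm_nonneg[of 0] by simp
  next
    case False
    then have pos: "\<nu> x > 0" using norm_nonneg[OF x] norm_eq_0[OF x] by fastforce
    then have "\<bar>\<mu> (inverse (\<nu> x) *\<^sub>R x)\<bar> \<le> 1" using x by (intro bound) (auto simp: norm_scale)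
    then show ?thesis using pos x by (simp add: sc abs_mult field_simps)
  qed
qed

text \<open>The upper gauge g, the least multiple of the unit above an element, is sublinear, so a linear
  functional lies below it. Tilting g towards b first forces the functional to take the value g b
  at b. A functional below g is 1 at the unit and bounded by the norm, hence a state.\<close>

lemma exists_norming_state:
  assumes b: "b \<in> S"
  shows "\<exists>\<mu>\<in>states A. b \<sqsubseteq> \<mu> b *\<^sub>R e"
proof -
  define g where "g x = Inf {s. x \<sqsubseteq> s *\<^sub>R e}" for x
  have lower: "- \<nu> x \<le> s" if "x \<in> S" "x \<sqsubseteq> s *\<^sub>R e" for x s
  proof -
    have "(- \<nu> x) *\<^sub>R e \<sqsubseteq> s *\<^sub>R e"
      using norm_bounds(2)[OF that(1)] that le_trans[of "- (\<nu> x *\<^sub>R e)" x "s *\<^sub>R e"] by simp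
    then show ?thesis by (simp only: unit_le_iff)
  qed
  have g_le: "g x \<le> s" if "x \<in> S" "x \<sqsubseteq> s *\<^sub>R e" for x s
    unfolding g_def using that lower[OF that(1)] by (intro cInf_lower bdd_belowI[of _ "- \<nu> x"]) auto
  have le_g: "x \<sqsubseteq> g x *\<^sub>R e" if "x \<in> S" for x
  proof (rule le_unit_archimedean[OF that])
    fix r assume "r > g x"
    have "{s. x \<sqsubseteq> s *\<^sub>R e} \<noteq> {}" using unit_dominates[OF that] by blast
    from cInf_lessD[OF this \<open>r > g x\<close>[unfolded g_def]]
    obtain s where "s < r" "x \<sqsubseteq> s *\<^sub>R e" by blast
    then show "x \<sqsubseteq> r *\<^sub>R e" using that le_unit_mono[of x s r] by simp
  qed
  have g_add: "g (x + y) \<le> g x + g y" if "x \<in> S" "y \<in> S" for x y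
    using le_add2[OF that(1) _ that(2) _ le_g[OF that(1)] le_g[OF that(2)]] that
    by (intro g_le) (auto simp: scaleR_add_left)
  have g_sc_le: "g (c *\<^sub>R x) \<le> c * g x" if "x \<in> S" "0 \<le> c" for c x
    using le_scale[OF that(1) _ that(2) le_g[OF that(1)]] that by (intro g_le) auto
  have g_sc: "g (c *\<^sub>R x) = c * g x" if "x \<in> S" "0 \<le> c" for c x
  proof (cases "c = 0")
    case True
    have "0 \<le> g 0" using le_g[of 0] unit_le_iff[of 0 "g 0"] by simp
    then show ?thesis using g_sc_le[of 0 0] True by simp
  next
    case False
    then show ?thesis
      using g_sc_le[OF that] g_sc_le[of "c *\<^sub>R x" "inverse c"] that
      by (intro antisym) (auto simp: field_simps)
  qed
  \<comment> \<open>A linear projection onto the space turns the gauge into a functional on the whole type.\<close>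
  obtain P :: "'v \<Rightarrow> 'v" where P: "linear P" "range P \<subseteq> S" "\<And>x. x \<in> S \<Longrightarrow> P x = x"
    using linear_exists_left_inverse_on[of "\<lambda>x. x" S] subspace_S by (auto simp: linear_id[unfolded id_def])
  have PS: "P x \<in> S" for x using P(2) by blast
  define p where "p = (\<lambda>x. g (P x))"
  have sp: "sublinear p"
    unfolding sublinear_def p_def using P(1) PS by (simp add: linear_add linear_scale g_add g_sc)
  obtain f where f: "linear f" "\<And>x. f x \<le> tilt p b x"
    using exists_linear_below_sublinear[OF tilt_props(1)[OF sp]] by blast
  have fg: "f x \<le> g x" if "x \<in> S" for x
    using f(2)[of x] tilt_props(2)[OF sp, of b x] P(3)[OF that] by (simp add: p_def)
  have fneg: "f (- x) = - f x" for x using f(1) by (simp add: linear_neg)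
  have fb: "g b \<le> f b"
    using f(2)[of "- b"] tilt_props(3)[OF sp, of b] P(3)[OF b] by (simp add: p_def fneg)
  define \<mu> where "\<mu> = restrict f S"
  have "\<mu> \<in> states A"
  proof (rule statesI)
    show "\<mu> \<in> extensional S" by (simp add: \<mu>_def)
    show "linear_map_on S \<mu>" using f(1) by (auto simp: linear_map_on_def \<mu>_def linear_add linear_scale)
    have "f e \<le> 1" using fg[of e] g_le[of e 1] le_refl by force
    moreover have "- f e \<le> -1"
      using fg[of "- e"] g_le[of "- e" "-1"] le_refl[of "- e"] fneg[of e] by simp
    ultimately show "\<mu> e = 1" by (simp add: \<mu>_def)
    fix x assume x: "x \<in> S"
    have "f x \<le> \<nu> x" "f (- x) \<le> \<nu> x"
      using fg[of x] fg[of "- x"] g_le[of x "\<nu> x"] g_le[of "- x" "\<nu> x"] norm_le_iff[OF x, of "\<nu> x"] x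
      by auto
    then show "\<bar>\<mu> x\<bar> \<le> \<nu> x" using x by (simp add: \<mu>_def fneg)
  qed
  moreover have "b \<sqsubseteq> \<mu> b *\<^sub>R e"
    using le_unit_mono[OF b le_g[OF b] fb] b by (simp add: \<mu>_def)
  ultimately show ?thesis by blast
qed

text \<open>States determine the norm, since some state is maximal at x and some state is maximal at - x.\<close>

lemma norm_le_states:
  assumes "x \<in> S" and "\<And>\<mu>. \<mu> \<in> states A \<Longrightarrow> \<bar>\<mu> x\<bar> \<le> c"
  shows "\<nu> x \<le> c"
proof -
  have "y \<sqsubseteq> c *\<^sub>R e" if y: "y = x \<or> y = - x" for y
  proof -
    have yS: "y \<in> S" using y assms(1) by auto
    obtain \<mu> where \<mu>: "\<mu> \<in> states A" "y \<sqsubseteq> \<mu> y *\<^sub>R e" using exists_norming_state[OF yS] by blast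
    have "\<mu> y \<le> c"
      using y assms(2)[OF \<mu>(1)] states_D(6)[OF \<mu>(1) assms(1), of "-1"] by auto
    then show ?thesis using le_unit_mono[OF yS \<mu>(2)] by simp
  qed
  then show ?thesis using norm_le_iff[OF assms(1)] by blast
qed

lemma segment_state:
  assumes "\<mu> \<in> states A" "\<kappa> \<in> states A" "0 \<le> s" "s \<le> 1"
  shows "restrict (\<lambda>x. (1 - s) * \<mu> x + s * \<kappa> x) S \<in> states A"
proof (rule statesI)
  note D = states_D[OF assms(1)] states_D[OF assms(2)]
  show "linear_map_on S (restrict (\<lambda>x. (1 - s) * \<mu> x + s * \<kappa> x) S)"
    using D by (auto simp: linear_map_on_def algebra_simps)
  fix x assume x: "x \<in> S"
  have "\<bar>(1 - s) * \<mu> x + s * \<kappa> x\<bar> \<le> \<bar>(1 - s) * \<mu> x\<bar> + \<bar>s * \<kappa> x\<bar>" by (rule abs_triangle_ineq)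
  also have "\<dots> \<le> (1 - s) * \<nu> x + s * \<nu> x"
    using assms(3,4) D(7,14) x by (auto simp: abs_mult intro!: add_mono mult_left_mono)
  finally show "\<bar>restrict (\<lambda>x. (1 - s) * \<mu> x + s * \<kappa> x) S x\<bar> \<le> \<nu> x"
    using x by (simp add: algebra_simps)
next
  show "restrict (\<lambda>x. (1 - s) * \<mu> x + s * \<kappa> x) S e = 1"
    using states_D(3)[OF assms(1)] states_D(3)[OF assms(2)] by simp
qed (use assms in auto)

text \<open>Banach-Alaoglu: by Tychonoff's theorem the functions bounded by the norm form a compact set, in
  which the states are cut out by linear equations.\<close>

lemma compact_states: "compact_space (weak_star_topology A)"
proof -
  define K where "K = PiE S (\<lambda>x. {- \<nu> x .. \<nu> x})"
  define X where "X = (powertop_real S)"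
  have top: "topspace X = extensional S" by (simp add: X_def PiE_def)
  have K: "compactin X K"
    unfolding X_def K_def by (subst compactin_PiE) auto
  have proj: "continuous_map X euclideanreal (\<lambda>\<mu>. \<mu> x)" if "x \<in> S" for x
    unfolding X_def using that by (rule continuous_map_product_projection)
  have cl: "closedin X {\<mu> \<in> topspace X. g \<mu> = 0}" if "continuous_map X euclideanreal g" for g
    using closedin_continuous_map_preimage[OF that, of "{0}"] by simp
  have cl_e: "closedin X {\<mu> \<in> topspace X. \<mu> e - 1 = 0}"
    by (intro cl continuous_map_diff proj) auto
  have cl_add: "closedin X {\<mu> \<in> topspace X. \<mu> (x + y) - (\<mu> x + \<mu> y) = 0}"
    if "x \<in> S" "y \<in> S" for x y
    using that by (intro cl continuous_map_diff continuous_map_add proj) auto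
  have cl_sc: "closedin X {\<mu> \<in> topspace X. \<mu> (c *\<^sub>R x) - c * \<mu> x = 0}" if "x \<in> S" for c x
    using that by (intro cl continuous_map_diff continuous_map_real_mult_left proj) auto
  define C where "C = {{\<mu> \<in> topspace X. \<mu> e - 1 = 0}} \<union>
     {{\<mu> \<in> topspace X. \<mu> (x + y) - (\<mu> x + \<mu> y) = 0} | x y. x \<in> S \<and> y \<in> S} \<union>
     {{\<mu> \<in> topspace X. \<mu> (c *\<^sub>R x) - c * \<mu> x = 0} | c x. x \<in> S}"
  have "closedin X (\<Inter>C)"
  proof (rule closedin_Inter)
    show "C \<noteq> {}" by (simp add: C_def)
    fix D assume "D \<in> C"
    then show "closedin X D"
      unfolding C_def using cl_e cl_add cl_sc by blast
  qed
  moreover have "states A = K \<inter> \<Inter>C"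
  proof (rule antisym)
    show "states A \<subseteq> K \<inter> \<Inter>C"
    proof
      fix \<mu> assume "\<mu> \<in> states A"
      note D = states_D[OF this]
      have "\<mu> \<in> K" unfolding K_def PiE_def using D(1) D(7) by (auto simp: abs_le_iff minus_le_iff)
      moreover have "\<mu> \<in> topspace X" using D(1) top by simp
      ultimately show "\<mu> \<in> K \<inter> \<Inter>C" using D by (auto simp: C_def)
    qed
    show "K \<inter> \<Inter>C \<subseteq> states A"
    proof
      fix \<mu> assume \<mu>: "\<mu> \<in> K \<inter> \<Inter>C"
      have add: "\<mu> (x + y) = \<mu> x + \<mu> y" if "x \<in> S" "y \<in> S" for x y
      proof -
        have "{\<mu> \<in> topspace X. \<mu> (x + y) - (\<mu> x + \<mu> y) = 0} \<in> C"
          unfolding C_def using that by blast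
        then have "\<mu> \<in> {\<mu> \<in> topspace X. \<mu> (x + y) - (\<mu> x + \<mu> y) = 0}"
          using \<mu> by (meson IntD2 InterE)
        then show ?thesis by simp
      qed
      have sc: "\<mu> (c *\<^sub>R x) = c * \<mu> x" if "x \<in> S" for c x
      proof -
        have "{\<mu> \<in> topspace X. \<mu> (c *\<^sub>R x) - c * \<mu> x = 0} \<in> C"
          unfolding C_def using that by blast
        then have "\<mu> \<in> {\<mu> \<in> topspace X. \<mu> (c *\<^sub>R x) - c * \<mu> x = 0}"
          using \<mu> by (meson IntD2 InterE)
        then show ?thesis by simp
      qed
      show "\<mu> \<in> states A"
      proof (rule statesI)
        show "\<mu> \<in> extensional S" "\<mu> e = 1" using \<mu> by (auto simp: K_def PiE_def C_def)
        show "linear_map_on S \<mu>" using add sc by (auto simp: linear_map_on_def)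
        show "\<bar>\<mu> x\<bar> \<le> \<nu> x" if "x \<in> S" for x
          using \<mu> that by (auto simp: K_def PiE_def Pi_def abs_le_iff minus_le_iff)
      qed
    qed
  qed
  ultimately have "compactin X (states A)" using compact_Int_closedin[OF K] by simp
  then show ?thesis unfolding weak_star_topology_def X_def by (rule compact_space_subtopology)
qed

end

section \<open>Compact quantum metric spaces\<close>

locale quantum_metric =
  fixes A :: "('v::real_vector, 'm) qms_scheme"
  assumes qms: "compact_qms A"

sublocale quantum_metric \<subseteq> order_unit A
  using qms by unfold_locales (simp add: compact_qms_def)

context quantum_metric
begin

abbreviation lip_seminorm :: "'v \<Rightarrow> real" ("L") where "L \<equiv> lip A"
abbreviation state_dist :: "('v \<Rightarrow> real) \<Rightarrow> ('v \<Rightarrow> real) \<Rightarrow> ennreal" ("\<rho>") where "\<rho> \<equiv> rho A"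
abbreviation radius :: real where "radius \<equiv> qms_radius A"

lemma L_scale: "x \<in> S \<Longrightarrow> L (c *\<^sub>R x) = \<bar>c\<bar> * L x"
  and L_unit: "L (c *\<^sub>R e) = 0"
  and rho_topology_eq: "rho_topology A = weak_star_topology A"
proof -
  show "x \<in> S \<Longrightarrow> L (c *\<^sub>R x) = \<bar>c\<bar> * L x" "rho_topology A = weak_star_topology A"
    using qms unfolding compact_qms_def seminorm_on_def by auto
  have "\<forall>a\<in>S. L a = 0 \<longleftrightarrow> (\<exists>r. a = r *\<^sub>R e)" using qms unfolding compact_qms_def by blast
  then show "L (c *\<^sub>R e) = 0" using S_simps(3,6) by blast
qed

lemma rho_upper: "x \<in> S \<Longrightarrow> L x \<le> 1 \<Longrightarrow> ennreal \<bar>\<mu> x - \<kappa> x\<bar> \<le> \<rho> \<mu> \<kappa>"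
  unfolding rho_def by (intro SUP_upper) auto

lemma rho_less_D: "\<rho> \<mu> \<kappa> < ennreal d \<Longrightarrow> x \<in> S \<Longrightarrow> L x \<le> 1 \<Longrightarrow> \<bar>\<mu> x - \<kappa> x\<bar> < d"
  using rho_upper[of x \<mu> \<kappa>] by (metis abs_ge_zero ennreal_less_iff order_le_less_trans)



lemma rho_triangle: "\<rho> \<mu> \<kappa> \<le> \<rho> \<mu> \<tau> + \<rho> \<tau> \<kappa>"
  unfolding rho_def[of A \<mu> \<kappa>]
proof (rule SUP_least)
  fix a assume a: "a \<in> {a \<in> S. L a \<le> 1}"
  have "ennreal \<bar>\<mu> a - \<kappa> a\<bar> \<le> ennreal (\<bar>\<mu> a - \<tau> a\<bar> + \<bar>\<tau> a - \<kappa> a\<bar>)" by (intro ennreal_leI) auto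
  also have "\<dots> = ennreal \<bar>\<mu> a - \<tau> a\<bar> + ennreal \<bar>\<tau> a - \<kappa> a\<bar>" by simp
  also have "\<dots> \<le> \<rho> \<mu> \<tau> + \<rho> \<tau> \<kappa>" using a by (intro add_mono rho_upper) auto
  finally show "ennreal \<bar>\<mu> a - \<kappa> a\<bar> \<le> \<rho> \<mu> \<tau> + \<rho> \<tau> \<kappa>" .
qed

lemma rho_self: "\<rho> \<mu> \<mu> = 0"
  unfolding rho_def by (auto intro!: antisym SUP_least)

lemma states_nonempty: "states A \<noteq> {}"
  using exists_norming_state[of 0] by auto

text \<open>The balls of the Lip-norm metric are open in the weak-* topology, for which the state space is
  compact.\<close>

lemma rho_totally_bounded:
  assumes "d > 0"
  shows "\<exists>F. finite F \<and> F \<subseteq> states A \<and> (\<forall>\<kappa>\<in>states A. \<exists>\<mu>\<in>F. \<rho> \<mu> \<kappa> < ennreal d)"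
proof -
  define B where "B \<mu> = {\<kappa> \<in> states A. \<rho> \<mu> \<kappa> < ennreal d}" for \<mu>
  have op: "openin (rho_topology A) (B \<mu>)" for \<mu>
    unfolding openin_rho_topology rho_open_def
  proof (intro conjI ballI)
    show "B \<mu> \<subseteq> states A" by (auto simp: B_def)
    fix \<kappa> assume \<kappa>: "\<kappa> \<in> B \<mu>"
    then obtain r where r: "0 \<le> r" "\<rho> \<mu> \<kappa> = ennreal r"
      by (cases "\<rho> \<mu> \<kappa>") (auto simp: B_def)
    then have rd: "r < d" using \<kappa> by (auto simp: B_def ennreal_less_iff)
    show "\<exists>\<epsilon>>0. \<forall>\<tau>\<in>states A. \<rho> \<kappa> \<tau> < \<epsilon> \<longrightarrow> \<tau> \<in> B \<mu>"
    proof (intro exI[of _ "ennreal (d - r)"] conjI ballI impI)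
      fix \<tau> assume \<tau>: "\<tau> \<in> states A" "\<rho> \<kappa> \<tau> < ennreal (d - r)"
      then obtain r' where r': "0 \<le> r'" "\<rho> \<kappa> \<tau> = ennreal r'"
        by (cases "\<rho> \<kappa> \<tau>") auto
      then have "r' < d - r" using \<tau> by (auto simp: ennreal_less_iff)
      have "\<rho> \<mu> \<tau> \<le> ennreal (r + r')"
        using rho_triangle[of \<mu> \<tau> \<kappa>] r r' by simp
      also have "\<dots> < ennreal d" using \<open>r' < d - r\<close> r r' by (intro ennreal_lessI) auto
      finally show "\<tau> \<in> B \<mu>" using \<tau> by (simp add: B_def)
    qed (use rd in simp)
  qed
  have "states A \<subseteq> extensional S" by (auto simp: states_def)
  then have top: "topspace (rho_topology A) = states A"
    by (auto simp: rho_topology_eq weak_star_topology_def PiE_def)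
  have "compactin (rho_topology A) (states A)"
    using compact_states by (metis compact_space_def rho_topology_eq top)
  then obtain \<F> where F: "finite \<F>" "\<F> \<subseteq> B ` states A" "states A \<subseteq> \<Union>\<F>"
  proof (rule compactinD[THEN exE])
    show "openin (rho_topology A) U" if "U \<in> B ` states A" for U using that op by auto
    show "states A \<subseteq> \<Union> (B ` states A)"
      using assms by (auto simp: B_def rho_self)
  qed blast
  obtain F where "finite F" "F \<subseteq> states A" "\<F> = B ` F"
    using finite_subset_image[OF F(1,2)] by blast
  then show ?thesis using F(3) by (intro exI[of _ F]) (auto simp: B_def)
qed

text \<open>The metric could a priori take the value infinity, since compactness alone does not bound the
  distance of two balls of a finite cover. Convexity does: cover the state space by k balls of
  radius 1, divide the segment between two states by k + 1 equidistant points, and let two of them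
  fall into one ball. Their distance is below 2, and at least 1/k of that between the end points.\<close>

lemma uniform_oscillation_bound:
  "\<exists>C. \<forall>\<mu>\<in>states A. \<forall>\<kappa>\<in>states A. \<forall>x\<in>S. L x \<le> 1 \<longrightarrow> \<bar>\<mu> x - \<kappa> x\<bar> \<le> C"
proof -
  obtain F where F: "finite F" "F \<subseteq> states A" "\<And>\<kappa>. \<kappa> \<in> states A \<Longrightarrow> \<exists>\<mu>\<in>F. \<rho> \<mu> \<kappa> < ennreal 1"
    using rho_totally_bounded[of 1] by auto
  define k where "k = card F"
  have k: "k > 0" using F states_nonempty unfolding k_def by (metis card_gt_0_iff ex_in_conv)
  have "\<bar>\<mu> x - \<kappa> x\<bar> \<le> 2 * real k" if \<mu>: "\<mu> \<in> states A" and \<kappa>: "\<kappa> \<in> states A" and x: "x \<in> S" "L x \<le> 1" for \<mu> \<kappa> x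
  proof -
    define m where "m j = restrict (\<lambda>x. (1 - real j / real k) * \<mu> x + (real j / real k) * \<kappa> x) S" for j
    have m: "m j \<in> states A" if "j \<le> k" for j
      unfolding m_def using that k by (intro segment_state \<mu> \<kappa>) auto
    obtain c where c: "\<And>j. j \<le> k \<Longrightarrow> c j \<in> F \<and> \<rho> (c j) (m j) < ennreal 1"
      using F(3)[OF m] by metis
    have "\<not> inj_on c {..k}"
    proof
      assume "inj_on c {..k}"
      then have "card {..k} \<le> card F" using c F(1) by (intro card_inj_on_le) auto
      then show False by (simp add: k_def)
    qed
    then obtain i j where ij: "i < j" "j \<le> k" "c i = c j"
      unfolding inj_on_def by (metis atMost_iff linorder_neqE_nat)
    have "\<bar>c i x - m i x\<bar> < 1" "\<bar>c i x - m j x\<bar> < 1"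
      using c[of i] c[of j] ij rho_less_D[OF _ x] by auto
    then have "\<bar>m i x - m j x\<bar> < 2" by linarith
    moreover have "m i x - m j x = (real j - real i) / real k * (\<mu> x - \<kappa> x)"
      using x k by (simp add: m_def field_simps)
    ultimately have "(real j - real i) / real k * \<bar>\<mu> x - \<kappa> x\<bar> < 2"
      using ij(1) by (simp add: abs_mult)
    then have "(real j - real i) * \<bar>\<mu> x - \<kappa> x\<bar> < 2 * real k"
      using k by (simp add: pos_divide_less_eq)
    moreover have "1 * \<bar>\<mu> x - \<kappa> x\<bar> \<le> (real j - real i) * \<bar>\<mu> x - \<kappa> x\<bar>"
      using ij by (intro mult_right_mono) auto
    ultimately show ?thesis by (simp only: mult_1)
  qed
  then show ?thesis by blast
qed

lemma diameter_eq: "(SUP \<mu>\<in>states A. SUP \<kappa>\<in>states A. \<rho> \<mu> \<kappa>) = ennreal (2 * radius)"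
proof -
  obtain C where C: "\<forall>\<mu>\<in>states A. \<forall>\<kappa>\<in>states A. \<forall>x\<in>S. L x \<le> 1 \<longrightarrow> \<bar>\<mu> x - \<kappa> x\<bar> \<le> C"
    using uniform_oscillation_bound by blast
  have "(SUP \<mu>\<in>states A. SUP \<kappa>\<in>states A. \<rho> \<mu> \<kappa>) \<le> ennreal C"
    unfolding rho_def using C by (auto intro!: SUP_least ennreal_leI)
  then have "(SUP \<mu>\<in>states A. SUP \<kappa>\<in>states A. \<rho> \<mu> \<kappa>) < \<infinity>"
    using ennreal_less_top le_less_trans by (metis infinity_ennreal_def)
  then show ?thesis by (simp add: qms_radius_def)
qed

lemma radius_nonneg: "0 \<le> radius"
  by (simp add: qms_radius_def)

lemma oscillation_le:
  assumes "\<mu> \<in> states A" "\<kappa> \<in> states A" "x \<in> S" "L x \<le> c" "c > 0"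
  shows "\<bar>\<mu> x - \<kappa> x\<bar> \<le> 2 * radius * c"
proof -
  let ?y = "inverse c *\<^sub>R x"
  have "ennreal \<bar>\<mu> ?y - \<kappa> ?y\<bar> \<le> \<rho> \<mu> \<kappa>"
    using assms by (intro rho_upper) (auto simp: L_scale field_simps)
  also have "\<dots> \<le> ennreal (2 * radius)"
    unfolding diameter_eq[symmetric] using assms by (intro SUP_upper2[of \<mu>] SUP_upper) auto
  finally have "\<bar>\<mu> ?y - \<kappa> ?y\<bar> \<le> 2 * radius" using radius_nonneg by simp
  moreover have "\<mu> ?y - \<kappa> ?y = (\<mu> x - \<kappa> x) / c"
    using states_D(6)[OF assms(1,3)] states_D(6)[OF assms(2,3)] by (simp add: divide_inverse_commute right_diff_distrib)
  ultimately have "\<bar>\<mu> x - \<kappa> x\<bar> / c \<le> 2 * radius" using assms(5) by (simp only: abs_divide)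
  then show ?thesis using assms(5) by (simp add: pos_divide_le_eq)
qed

text \<open>The diameter is a supremum, so some oscillation exceeds any smaller bound. A negative bound needs
  a separate argument, with x = 0, because the extended nonnegative reals truncate it to 0.\<close>

lemma oscillation_near_diameter:
  assumes "\<eta> > 0"
  shows "\<exists>\<mu>\<in>states A. \<exists>\<kappa>\<in>states A. \<exists>x\<in>S. L x \<le> 1 \<and> \<mu> x - \<kappa> x > 2 * radius - \<eta>"
proof (cases "2 * radius - \<eta> < 0")
  case True
  obtain \<mu> where "\<mu> \<in> states A" using states_nonempty by blast
  then show ?thesis using True L_unit[of 0] by (intro bexI[of _ \<mu>] bexI[of _ 0]) auto
next
  case False
  then have "ennreal (2 * radius - \<eta>) < (SUP \<mu>\<in>states A. SUP \<kappa>\<in>states A. \<rho> \<mu> \<kappa>)"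
    unfolding diameter_eq using assms by (simp add: ennreal_less_iff)
  then obtain \<mu> \<kappa> x where *: "\<mu> \<in> states A" "\<kappa> \<in> states A" "x \<in> S" "L x \<le> 1"
    and "ennreal (2 * radius - \<eta>) < ennreal \<bar>\<mu> x - \<kappa> x\<bar>"
    unfolding rho_def less_SUP_iff by blast
  then have "2 * radius - \<eta> < \<bar>\<mu> x - \<kappa> x\<bar>" using False by (simp add: ennreal_less_iff)
  then have "2 * radius - \<eta> < \<mu> x - \<kappa> x \<or> 2 * radius - \<eta> < \<kappa> x - \<mu> x" by linarith
  then show ?thesis using * by blast
qed

text \<open>The next two lemmas express oscillations over the state space by norms, which vary continuously
  along the sections of a field: adding K e to x makes it positive when K is large, and the norm of
  a positive element is the largest value that a state takes on it.\<close>

lemma state_difference_le_norms: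
  assumes "\<mu> \<in> states A" "\<kappa> \<in> states A" "x \<in> S"
  shows "\<mu> x - \<kappa> x \<le> \<nu> (x + K *\<^sub>R e) + \<nu> (K *\<^sub>R e - x) - 2 * K"
proof -
  note D = states_D[OF assms(1)] and D' = states_D[OF assms(2)]
  have "\<mu> x + K \<le> \<nu> (x + K *\<^sub>R e)"
    using D(7)[of "x + K *\<^sub>R e"] D(4)[of x "K *\<^sub>R e"] D(6)[of e K] D(3) assms(3) by auto
  moreover have "K - \<kappa> x \<le> \<nu> (K *\<^sub>R e - x)"
    using D'(7)[of "K *\<^sub>R e - x"] D'(5)[of "K *\<^sub>R e" x] D'(6)[of e K] D'(3) assms(3) by auto
  ultimately show ?thesis by linarith
qed

lemma shifted_norms_le:
  assumes x: "x \<in> S" and L: "L x \<le> c" "c > 0" and K: "\<nu> x \<le> K"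
  shows "\<nu> (x + K *\<^sub>R e) + \<nu> (K *\<^sub>R e - x) - 2 * K \<le> 2 * radius * c"
proof -
  have one: "\<exists>\<mu>\<in>states A. \<nu> (y + K *\<^sub>R e) \<le> \<mu> y + K" if y: "y \<in> S" "\<nu> y \<le> K" for y
  proof -
    obtain \<mu> where \<mu>: "\<mu> \<in> states A" "y \<sqsubseteq> \<mu> y *\<^sub>R e" using exists_norming_state[OF y(1)] by blast
    have "y + K *\<^sub>R e \<sqsubseteq> (\<mu> y + K) *\<^sub>R e"
      using le_add[OF y(1) _ _ \<mu>(2), of "K *\<^sub>R e"] by (simp add: scaleR_add_left)
    moreover have "- (y + K *\<^sub>R e) \<sqsubseteq> (\<mu> y + K) *\<^sub>R e"
    proof (rule le_trans[of _ "0 *\<^sub>R e"])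
      have "- y \<sqsubseteq> K *\<^sub>R e" using norm_le_iff[OF y(1)] y(2) by blast
      then show "- (y + K *\<^sub>R e) \<sqsubseteq> 0 *\<^sub>R e"
        using le_add[of "- y" "K *\<^sub>R e" "- (K *\<^sub>R e)"] y(1) by simp
      have "0 \<le> \<mu> y + K" using states_D(7)[OF \<mu>(1) y(1)] y(2) by linarith
      then show "0 *\<^sub>R e \<sqsubseteq> (\<mu> y + K) *\<^sub>R e" unfolding unit_le_iff .
    qed (use y in auto)
    ultimately show ?thesis using norm_le_iff[of "y + K *\<^sub>R e"] y(1) \<mu>(1) by auto
  qed
  obtain \<mu> where \<mu>: "\<mu> \<in> states A" "\<nu> (x + K *\<^sub>R e) \<le> \<mu> x + K" using one[OF x K] by blast
  obtain \<kappa> where \<kappa>: "\<kappa> \<in> states A" "\<nu> (- x + K *\<^sub>R e) \<le> \<kappa> (- x) + K"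
    using one[of "- x"] x K norm_minus by auto
  have "\<kappa> (- x) = - \<kappa> x" using states_D(6)[OF \<kappa>(1) x, of "-1"] by simp
  then have "\<nu> (x + K *\<^sub>R e) + \<nu> (K *\<^sub>R e - x) \<le> \<mu> x - \<kappa> x + 2 * K"
    using \<mu>(2) \<kappa>(2) by (simp add: add.commute)
  then show ?thesis using oscillation_le[OF \<mu>(1) \<kappa>(1) x L] by linarith
qed

text \<open>This element has the largest norm in the ball, so the ball determines the radius.\<close>

lemma unit_in_lip_ball: "radius *\<^sub>R e \<in> lip_ball A"
  using L_unit[of radius] radius_nonneg norm_e by (auto simp: lip_ball_def lip_ball_r_def norm_scale)

lemma zero_in_lip_ball: "0 \<in> lip_ball A"
  using L_unit[of 0] radius_nonneg norm_scale[of 0 0] by (auto simp: lip_ball_def lip_ball_r_def)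

text \<open>Total boundedness of the ball, in terms of separated families. On elements with Lip-norm at most 1
  every state agrees up to s/4 with one of the finitely many states of a net. Rounding the
  values at the net down to multiples of s/4 sorts the ball into finitely many classes, and two
  elements of one class differ in norm by at most s.\<close>

lemma lip_ball_r_packing:
  assumes s: "s > 0"
  shows "\<exists>n::nat. \<forall>k p. (\<forall>i<k. p i \<in> lip_ball_r A r) \<longrightarrow>
    (\<forall>i<k. \<forall>j<k. i \<noteq> j \<longrightarrow> s < \<nu> (p i - p j)) \<longrightarrow> k \<le> n"
proof -
  obtain F where F: "finite F" "F \<subseteq> states A"
    "\<And>\<kappa>. \<kappa> \<in> states A \<Longrightarrow> \<exists>\<mu>\<in>F. \<rho> \<mu> \<kappa> < ennreal (s / 4)"
    using rho_totally_bounded[of "s / 4"] s by auto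
  have floor_one: "\<bar>u - v\<bar> < 1" if "\<lfloor>u\<rfloor> = \<lfloor>v\<rfloor>" for u v :: real using that by linarith
  define q where "q a = restrict (\<lambda>\<mu>. \<lfloor>\<mu> a / (s / 4)\<rfloor>) F" for a
  define Q where "Q = PiE F (\<lambda>_. {\<lfloor>- r / (s / 4)\<rfloor> .. \<lfloor>r / (s / 4)\<rfloor>})"
  have Q: "finite Q" unfolding Q_def using F(1) by (intro finite_PiE) auto
  have qQ: "q a \<in> Q" if a: "a \<in> lip_ball_r A r" for a
  proof -
    have "\<lfloor>- r / (s / 4)\<rfloor> \<le> \<lfloor>\<mu> a / (s / 4)\<rfloor> \<and> \<lfloor>\<mu> a / (s / 4)\<rfloor> \<le> \<lfloor>r / (s / 4)\<rfloor>" if "\<mu> \<in> F" for \<mu>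
    proof -
      have "\<bar>\<mu> a\<bar> \<le> r" using states_D(7)[of \<mu> a] that F(2) a by (fastforce simp: lip_ball_r_def)
      then show ?thesis using s by (intro conjI floor_mono divide_right_mono) auto
    qed
    then show ?thesis by (auto simp: Q_def q_def)
  qed
  have close: "\<nu> (a - b) \<le> s" if a: "a \<in> lip_ball_r A r" and b: "b \<in> lip_ball_r A r" and "q a = q b" for a b
  proof (rule norm_le_states)
    show "a - b \<in> S" using a b by (auto simp: lip_ball_r_def)
    fix \<kappa> assume \<kappa>: "\<kappa> \<in> states A"
    obtain \<mu> where \<mu>: "\<mu> \<in> F" "\<rho> \<mu> \<kappa> < ennreal (s / 4)" using F(3)[OF \<kappa>] by blast
    have "\<lfloor>\<mu> a / (s / 4)\<rfloor> = \<lfloor>\<mu> b / (s / 4)\<rfloor>"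
      using fun_cong[OF \<open>q a = q b\<close>, of \<mu>] \<mu>(1) by (simp only: q_def restrict_apply if_True)
    then have "\<bar>\<mu> a / (s / 4) - \<mu> b / (s / 4)\<bar> < 1" by (rule floor_one)
    then have "\<bar>(\<mu> a - \<mu> b) / (s / 4)\<bar> < 1" by (simp only: diff_divide_distrib)
    then have "\<bar>\<mu> a - \<mu> b\<bar> / (s / 4) < 1" using s by (simp only: abs_divide)
    then have "\<bar>\<mu> a - \<mu> b\<bar> < s / 4" using s by (simp add: pos_divide_less_eq)
    moreover have "\<bar>\<mu> a - \<kappa> a\<bar> < s / 4" "\<bar>\<mu> b - \<kappa> b\<bar> < s / 4"
      using rho_less_D[OF \<mu>(2)] a b by (auto simp: lip_ball_r_def)
    ultimately have "\<bar>\<kappa> a - \<kappa> b\<bar> \<le> s" by linarith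
    then show "\<bar>\<kappa> (a - b)\<bar> \<le> s"
      using states_D(5)[OF \<kappa>, of a b] a b by (auto simp: lip_ball_r_def)
  qed
  have "k \<le> card Q" if p: "\<forall>i<k. p i \<in> lip_ball_r A r"
    and sep: "\<forall>i<k. \<forall>j<k. i \<noteq> j \<longrightarrow> s < \<nu> (p i - p j)" for k :: nat and p
  proof -
    have "inj_on (\<lambda>i. q (p i)) {..<k}"
      unfolding inj_on_def using p sep close by (metis lessThan_iff not_le)
    moreover have "(\<lambda>i. q (p i)) ` {..<k} \<subseteq> Q" using p qQ by auto
    ultimately have "card {..<k} \<le> card Q" using Q by (intro card_inj_on_le)
    then show ?thesis by simp
  qed
  then show ?thesis by blast
qed

end

section \<open>Normed spaces\<close>

lemma normed_space_D:
  assumes "normed_space_on V N"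
  shows "subspace V" "x \<in> V \<Longrightarrow> 0 \<le> N x" "x \<in> V \<Longrightarrow> y \<in> V \<Longrightarrow> N (x + y) \<le> N x + N y"
    "x \<in> V \<Longrightarrow> N (c *\<^sub>R x) = \<bar>c\<bar> * N x" "N 0 = 0" "x \<in> V \<Longrightarrow> N (- x) = N x"
    "x \<in> V \<Longrightarrow> y \<in> V \<Longrightarrow> N (x - y) \<le> N x + N y" "x \<in> V \<Longrightarrow> N x = 0 \<Longrightarrow> x = 0"
    "x \<in> V \<Longrightarrow> y \<in> V \<Longrightarrow> \<bar>N x - N y\<bar> \<le> N (x - y)"
    "x \<in> V \<Longrightarrow> y \<in> V \<Longrightarrow> N (x - y) = N (y - x)"
proof -
  show sub: "subspace V" and "x \<in> V \<Longrightarrow> 0 \<le> N x" and "x \<in> V \<Longrightarrow> N x = 0 \<Longrightarrow> x = 0"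
    and add: "x \<in> V \<Longrightarrow> y \<in> V \<Longrightarrow> N (x + y) \<le> N x + N y"
    and sc: "x \<in> V \<Longrightarrow> N (c *\<^sub>R x) = \<bar>c\<bar> * N x" for c x y
    using assms by (auto simp: normed_space_on_def seminorm_on_def)
  show "N 0 = 0" using sc[of 0 0] subspace_0[OF sub] by simp
  show neg: "x \<in> V \<Longrightarrow> N (- x) = N x" for x using sc[of x "-1"] by simp
  show "x \<in> V \<Longrightarrow> y \<in> V \<Longrightarrow> N (x - y) \<le> N x + N y"
    using add[of x "- y"] neg[of y] subspace_neg[OF sub] by simp
  show dsym: "N (x - y) = N (y - x)" if "x \<in> V" "y \<in> V" for x y
    using neg[of "x - y"] subspace_diff[OF sub that] by simp
  show "\<bar>N x - N y\<bar> \<le> N (x - y)" if "x \<in> V" "y \<in> V"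
    using add[of "x - y" y] add[of "y - x" x] dsym[OF that] subspace_diff[OF sub] that by fastforce
qed

lemma normed_space_sum_le:
  assumes "normed_space_on V N" "finite J" "\<And>j. j \<in> J \<Longrightarrow> u j \<in> V"
  shows "N (\<Sum>j\<in>J. c j *\<^sub>R u j) \<le> (\<Sum>j\<in>J. \<bar>c j\<bar> * N (u j))"
  using assms(2,3)
proof (induction J)
  case empty
  then show ?case using normed_space_D(5)[OF assms(1)] by simp
next
  case (insert j J)
  note D = normed_space_D[OF assms(1)]
  have "N (\<Sum>i\<in>insert j J. c i *\<^sub>R u i) \<le> N (c j *\<^sub>R u j) + N (\<Sum>i\<in>J. c i *\<^sub>R u i)"
    using insert D(3) by (simp add: subspace_sum[OF D(1)] subspace_scale[OF D(1)])
  then show ?case using insert D(4) by simp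
qed

text \<open>Glueing two normed spaces so that u j and w j come within \<delta> of each other. The norm P of
  a pair is the least cost of decomposing it into a vector of V, a vector of W and a combination of
  the vectors (u j, - w j), each of which costs \<delta>. The comparison hypothesis says that moving a
  combination from V to W gains nothing, so P restricts to the given norms. Since \<delta> is positive,
  a small cost forces small coefficients, which makes P definite and not only a seminorm.\<close>

lemma amalgamated_norm:
  fixes u :: "'i \<Rightarrow> 'a::real_vector" and w :: "'i \<Rightarrow> 'b::real_vector"
  assumes V: "normed_space_on V M" and W: "normed_space_on W N" and J: "finite J"
    and u: "\<And>j. j \<in> J \<Longrightarrow> u j \<in> V" and w: "\<And>j. j \<in> J \<Longrightarrow> w j \<in> W" and \<delta>: "\<delta> > 0"
    and cmp: "\<And>c. \<bar>M (\<Sum>j\<in>J. c j *\<^sub>R u j) - N (\<Sum>j\<in>J. c j *\<^sub>R w j)\<bar> \<le> \<delta> * (\<Sum>j\<in>J. \<bar>c j\<bar>)"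
  shows "\<exists>P. normed_space_on (V \<times> W) P \<and> (\<forall>x\<in>V. P (x, 0) = M x) \<and> (\<forall>y\<in>W. P (0, y) = N y) \<and>
    (\<forall>j\<in>J. P (u j, - w j) \<le> \<delta>)"
proof -
  note DV = normed_space_D[OF V] and DW = normed_space_D[OF W]
  note sV = subspace_sum[OF DV(1)] subspace_scale[OF DV(1)] subspace_add[OF DV(1)] subspace_diff[OF DV(1)]
    subspace_0[OF DV(1)]
  note sW = subspace_sum[OF DW(1)] subspace_scale[OF DW(1)] subspace_add[OF DW(1)] subspace_diff[OF DW(1)]
    subspace_0[OF DW(1)] subspace_neg[OF DW(1)]
  define U where "U c = (\<Sum>j\<in>J. c j *\<^sub>R u j)" for c
  define Y where "Y c = (\<Sum>j\<in>J. c j *\<^sub>R w j)" for c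
  define l where "l c = (\<Sum>j\<in>J. \<bar>c j\<bar>)" for c :: "'i \<Rightarrow> real"
  have UV: "U c \<in> V" and YW: "Y c \<in> W" for c using u w by (auto simp: U_def Y_def intro!: sV sW)
  have U_add: "U (\<lambda>j. c j + d j) = U c + U d" and Y_add: "Y (\<lambda>j. c j + d j) = Y c + Y d" for c d
    by (simp_all add: U_def Y_def scaleR_add_left sum.distrib)
  have U_sc: "U (\<lambda>j. t * c j) = t *\<^sub>R U c" and Y_sc: "Y (\<lambda>j. t * c j) = t *\<^sub>R Y c" for t c
    by (simp_all add: U_def Y_def scaleR_sum_right)
  have l_add: "l (\<lambda>j. c j + d j) \<le> l c + l d" for c d
    unfolding l_def by (subst sum.distrib[symmetric]) (auto intro!: sum_mono)
  have l_sc: "l (\<lambda>j. t * c j) = \<bar>t\<bar> * l c" for t c by (simp add: l_def abs_mult sum_distrib_left)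
  have l_nonneg: "0 \<le> l c" for c by (simp add: l_def sum_nonneg)
  have zero: "U (\<lambda>_. 0) = 0" "Y (\<lambda>_. 0) = 0" "l (\<lambda>_. 0) = 0" by (auto simp: U_def Y_def l_def)
  define F where "F p c = M (fst p - U c) + N (snd p + Y c) + \<delta> * l c" for p c
  define P where "P p = (INF c. F p c)" for p
  have F_nonneg: "0 \<le> F p c" if "p \<in> V \<times> W" for p c
    unfolding F_def using that UV YW l_nonneg \<delta>
    by (intro add_nonneg_nonneg DV(2) DW(2) mult_nonneg_nonneg sV sW) auto
  have low: "P p \<le> F p c" if "p \<in> V \<times> W" for p c
    unfolding P_def using F_nonneg[OF that] by (intro cINF_lower bdd_belowI2[of _ 0]) auto
  have great: "m \<le> P p" if "\<And>c. m \<le> F p c" for m p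
    unfolding P_def using that by (intro cINF_greatest) auto
  have F_add: "F (p + q) (\<lambda>j. c j + d j) \<le> F p c + F q d" if "p \<in> V \<times> W" "q \<in> V \<times> W" for p q c d
  proof -
    have "M (fst (p + q) - U (\<lambda>j. c j + d j)) \<le> M (fst p - U c) + M (fst q - U d)"
      using DV(3)[of "fst p - U c" "fst q - U d"] that UV sV by (auto simp: U_add algebra_simps)
    moreover have "N (snd (p + q) + Y (\<lambda>j. c j + d j)) \<le> N (snd p + Y c) + N (snd q + Y d)"
      using DW(3)[of "snd p + Y c" "snd q + Y d"] that YW sW by (auto simp: Y_add algebra_simps)
    moreover have "\<delta> * l (\<lambda>j. c j + d j) \<le> \<delta> * l c + \<delta> * l d"
      using mult_left_mono[OF l_add[of c d], of \<delta>] \<delta> by (simp add: algebra_simps)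
    ultimately show ?thesis by (simp add: F_def)
  qed
  have F_sc: "F (t *\<^sub>R p) (\<lambda>j. t * c j) = \<bar>t\<bar> * F p c" if "p \<in> V \<times> W" for t p c
  proof -
    have "M (fst (t *\<^sub>R p) - U (\<lambda>j. t * c j)) = \<bar>t\<bar> * M (fst p - U c)"
      using DV(4)[of "fst p - U c" t] that UV sV by (auto simp: U_sc algebra_simps)
    moreover have "N (snd (t *\<^sub>R p) + Y (\<lambda>j. t * c j)) = \<bar>t\<bar> * N (snd p + Y c)"
      using DW(4)[of "snd p + Y c" t] that YW sW by (auto simp: Y_sc algebra_simps)
    ultimately show ?thesis by (simp add: F_def l_sc algebra_simps)
  qed
  have PM: "P (x, 0) = M x" if "x \<in> V" for x
  proof (rule antisym)
    show "P (x, 0) \<le> M x"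
      using low[of "(x, 0)" "\<lambda>_. 0"] that sW by (simp add: F_def zero DW(5))
    show "M x \<le> P (x, 0)"
    proof (rule great)
      fix c
      have "M x \<le> M (x - U c) + M (U c)" using DV(3)[of "x - U c" "U c"] that UV sV by simp
      moreover have "M (U c) \<le> N (Y c) + \<delta> * l c"
        using cmp[of c] unfolding U_def[symmetric] Y_def[symmetric] l_def[symmetric] by linarith
      ultimately show "M x \<le> F (x, 0) c" by (simp add: F_def)
    qed
  qed
  have PN: "P (0, y) = N y" if "y \<in> W" for y
  proof (rule antisym)
    show "P (0, y) \<le> N y"
      using low[of "(0, y)" "\<lambda>_. 0"] that sV by (simp add: F_def zero DV(5))
    show "N y \<le> P (0, y)"
    proof (rule great)
      fix c
      have "N y \<le> N (y + Y c) + N (Y c)" using DW(7)[of "y + Y c" "Y c"] that YW sW by simp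
      moreover have "N (Y c) \<le> M (U c) + \<delta> * l c"
        using cmp[of c] unfolding U_def[symmetric] Y_def[symmetric] l_def[symmetric] by linarith
      ultimately show "N y \<le> F (0, y) c" by (simp add: F_def DV(6)[OF UV])
    qed
  qed
  have Pu: "P (u j, - w j) \<le> \<delta>" if j: "j \<in> J" for j
  proof -
    define c where "c i = (if i = j then 1 else 0 :: real)" for i
    have "U c = u j" "Y c = w j" "l c = 1"
      using j J by (auto simp: U_def Y_def l_def c_def if_distrib[of abs] if_distrib[of "\<lambda>r. r *\<^sub>R _"]
          cong: if_cong)
    then show ?thesis
      using low[of "(u j, - w j)" c] u[OF j] w[OF j] sW by (simp add: F_def DV(5) DW(5))
  qed
  have P_add: "P (p + q) \<le> P p + P q" if pq: "p \<in> V \<times> W" "q \<in> V \<times> W" for p q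
  proof -
    have pqV: "p + q \<in> V \<times> W" using pq sV sW by auto
    have "P (p + q) - F q d \<le> F p c" for c d
      using low[OF pqV, of "\<lambda>j. c j + d j"] F_add[OF pq, of c d] by linarith
    then have "P (p + q) - F q d \<le> P p" for d by (rule great)
    then have "P (p + q) - P p \<le> F q d" for d by (simp add: algebra_simps)
    then have "P (p + q) - P p \<le> P q" by (rule great)
    then show ?thesis by simp
  qed
  have P_nonneg: "0 \<le> P p" if "p \<in> V \<times> W" for p using F_nonneg[OF that] by (rule great)
  have P_sc: "P (t *\<^sub>R p) = \<bar>t\<bar> * P p" if p: "p \<in> V \<times> W" for t p
  proof (cases "t = 0")
    case True
    then show ?thesis using PM[of 0] sV DV(5) by (simp flip: zero_prod_def)
  next
    case False
    have le: "P (t *\<^sub>R p) \<le> \<bar>t\<bar> * P p" if "t \<noteq> 0" "p \<in> V \<times> W" for t p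
    proof -
      have tp: "t *\<^sub>R p \<in> V \<times> W" using that sV sW by (cases p) auto
      have "P (t *\<^sub>R p) / \<bar>t\<bar> \<le> F p c" for c
        using low[OF tp, of "\<lambda>j. t * c j"] F_sc[OF that(2), of t c] that by (simp add: field_simps)
      then have "P (t *\<^sub>R p) / \<bar>t\<bar> \<le> P p" by (rule great)
      then show ?thesis using that by (simp add: field_simps)
    qed
    have tp: "t *\<^sub>R p \<in> V \<times> W" using p sV sW by (cases p) auto
    have "P p \<le> \<bar>inverse t\<bar> * P (t *\<^sub>R p)" using le[OF _ tp, of "inverse t"] False by simp
    then have "\<bar>t\<bar> * P p \<le> P (t *\<^sub>R p)" using False by (simp add: field_simps)
    then show ?thesis using le[OF False p] by simp
  qed
  \<comment> \<open>A combination costs \<delta> times the sum l c of its coefficients and has norm at most B times that sum,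
      so both norms are bounded by 1 + B / \<delta> times the cost.\<close>
  have definite: "x = 0 \<and> y = 0" if x: "x \<in> V" and y: "y \<in> W" and 0: "P (x, y) = 0" for x y
  proof -
    define B where "B = (\<Sum>j\<in>J. M (u j) + N (w j))"
    have B0: "0 \<le> B" unfolding B_def using u w DV(2) DW(2) by (intro sum_nonneg add_nonneg_nonneg) auto
    have MB: "M (u j) \<le> B" "N (w j) \<le> B" if "j \<in> J" for j
    proof -
      have "M (u j) + N (w j) \<le> B"
        unfolding B_def using that J u w DV(2) DW(2) by (intro member_le_sum add_nonneg_nonneg) auto
      then show "M (u j) \<le> B" "N (w j) \<le> B" using DV(2)[OF u[OF that]] DW(2)[OF w[OF that]] by auto
    qed
    have UB: "M (U c) \<le> B * l c" for c
    proof -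
      have "M (U c) \<le> (\<Sum>j\<in>J. \<bar>c j\<bar> * M (u j))"
        unfolding U_def by (rule normed_space_sum_le[OF V J u])
      also have "\<dots> \<le> (\<Sum>j\<in>J. \<bar>c j\<bar> * B)" using MB by (intro sum_mono mult_left_mono) auto
      finally show ?thesis by (simp add: l_def sum_distrib_left mult.commute)
    qed
    have YB: "N (Y c) \<le> B * l c" for c
    proof -
      have "N (Y c) \<le> (\<Sum>j\<in>J. \<bar>c j\<bar> * N (w j))"
        unfolding Y_def by (rule normed_space_sum_le[OF W J w])
      also have "\<dots> \<le> (\<Sum>j\<in>J. \<bar>c j\<bar> * B)" using MB by (intro sum_mono mult_left_mono) auto
      finally show ?thesis by (simp add: l_def sum_distrib_left mult.commute)
    qed
    define C where "C = 1 + B / \<delta>"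
    have C: "C \<ge> 1" using B0 \<delta> by (simp add: C_def)
    have bound: "z \<le> C * F (x, y) c" if "z \<le> M (x - U c) + N (y + Y c) + B * l c" for z c
    proof -
      have n: "0 \<le> M (x - U c) + N (y + Y c)"
        using x y UV YW by (intro add_nonneg_nonneg DV(2) DW(2) sV sW) auto
      have "B * l c \<le> C * (\<delta> * l c)"
        using \<delta> l_nonneg[of c] by (simp add: C_def field_simps)
      moreover have "1 * (M (x - U c) + N (y + Y c)) \<le> C * (M (x - U c) + N (y + Y c))"
        by (rule mult_right_mono[OF C n])
      ultimately show ?thesis using that by (simp add: F_def algebra_simps)
    qed
    have "M x / C \<le> F (x, y) c" "N y / C \<le> F (x, y) c" for c
    proof -
      have "M x \<le> M (x - U c) + M (U c)" using DV(3)[of "x - U c" "U c"] x UV sV by simp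
      then have "M x \<le> M (x - U c) + N (y + Y c) + B * l c"
        using UB[of c] DW(2)[of "y + Y c"] y YW sW by simp
      from bound[OF this] show "M x / C \<le> F (x, y) c" using C by (simp add: field_simps)
      have "N y \<le> N (y + Y c) + N (Y c)" using DW(7)[of "y + Y c" "Y c"] y YW sW by simp
      then have "N y \<le> M (x - U c) + N (y + Y c) + B * l c"
        using YB[of c] DV(2)[of "x - U c"] x UV sV by simp
      from bound[OF this] show "N y / C \<le> F (x, y) c" using C by (simp add: field_simps)
    qed
    then have "M x / C \<le> 0" "N y / C \<le> 0" using great 0 by metis+
    then have "M x \<le> 0" "N y \<le> 0" using C by (auto simp: divide_le_0_iff)
    then show ?thesis using DV(2,8)[OF x] DW(2,8)[OF y] by auto
  qed
  have "normed_space_on (V \<times> W) P"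
    unfolding normed_space_on_def seminorm_on_def
    using subspace_Times[OF DV(1) DW(1)] P_nonneg P_add P_sc definite by (auto simp: zero_prod_def)
  then show ?thesis using PM PN Pu by blast
qed

section \<open>Hausdorff and Gromov-Hausdorff distance\<close>

lemma hausdorff_dist_leI:
  assumes "\<And>x. x \<in> X \<Longrightarrow> \<exists>y\<in>Y. d x y \<le> r" "\<And>y. y \<in> Y \<Longrightarrow> \<exists>x\<in>X. d x y \<le> r"
  shows "hausdorff_dist d X Y \<le> ennreal r"
proof -
  have "(INF y\<in>Y. ennreal (d x y)) \<le> ennreal r" if "x \<in> X" for x
    using assms(1)[OF that] by (meson INF_lower2 ennreal_leI)
  moreover have "(INF x\<in>X. ennreal (d x y)) \<le> ennreal r" if "y \<in> Y" for y
    using assms(2)[OF that] by (meson INF_lower2 ennreal_leI)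
  ultimately show ?thesis by (simp add: hausdorff_dist_def SUP_least)
qed

lemma hausdorff_dist_lessD:
  assumes "hausdorff_dist d X Y < ennreal r" "x \<in> X"
  shows "\<exists>y\<in>Y. d x y < r"
proof -
  have "(INF y\<in>Y. ennreal (d x y)) \<le> hausdorff_dist d X Y"
    unfolding hausdorff_dist_def using assms(2) by (intro max.coboundedI1 SUP_upper)
  then have "(INF y\<in>Y. ennreal (d x y)) < ennreal r" using assms(1) by simp
  then obtain y where "y \<in> Y" "ennreal (d x y) < ennreal r" by (auto simp: INF_less_iff)
  then show ?thesis by (metis ennreal_leI not_le)
qed

text \<open>Sending each point to one that is near it in a common metric space changes distances by less than
  2 r. One direction of the estimate suffices to transport separated families.\<close>

lemma dist_GH_lessD:
  assumes "dist_GH X dX Y dY < ennreal r"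
  shows "\<exists>\<phi>. \<phi> \<in> X \<rightarrow> Y \<and> (\<forall>x\<in>X. \<forall>x'\<in>X. dX x x' < dY (\<phi> x) (\<phi> x') + 2 * r)"
proof -
  obtain Z :: "('a + 'b) set" and dZ hX hY where Z: "Metric_space Z dZ"
    and hX: "isometric_embedding X dX Z dZ hX" and hY: "isometric_embedding Y dY Z dZ hY"
    and less: "hausdorff_dist dZ (hX ` X) (hY ` Y) < ennreal r"
    using assms unfolding dist_GH_def Inf_less_iff by blast
  interpret Metric_space Z dZ by fact
  have "\<exists>y\<in>Y. dZ (hX x) (hY y) < r" if "x \<in> X" for x
    using hausdorff_dist_lessD[OF less, of "hX x"] that by auto
  then obtain \<phi> where \<phi>: "\<And>x. x \<in> X \<Longrightarrow> \<phi> x \<in> Y \<and> dZ (hX x) (hY (\<phi> x)) < r" by metis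
  have "dX x x' < dY (\<phi> x) (\<phi> x') + 2 * r" if x: "x \<in> X" "x' \<in> X" for x x'
  proof -
    have in_Z: "hX x \<in> Z" "hX x' \<in> Z" "hY (\<phi> x) \<in> Z" "hY (\<phi> x') \<in> Z"
      using hX hY \<phi> x by (auto simp: isometric_embedding_def)
    have "dZ (hX x) (hX x') \<le> dZ (hX x) (hY (\<phi> x)) + dZ (hY (\<phi> x)) (hY (\<phi> x')) + dZ (hY (\<phi> x')) (hX x')"
      using triangle[OF in_Z(1,3,2)] triangle[OF in_Z(3,4,2)] by linarith
    moreover have "dZ (hX x) (hX x') = dX x x'" "dZ (hY (\<phi> x)) (hY (\<phi> x')) = dY (\<phi> x) (\<phi> x')"
      using hX hY \<phi> x by (auto simp: isometric_embedding_def)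
    moreover have "dZ (hX x) (hY (\<phi> x)) < r" "dZ (hY (\<phi> x')) (hX x') < r"
      using \<phi> x by (auto simp: commute)
    ultimately show ?thesis by linarith
  qed
  then show ?thesis using \<phi> by blast
qed

lemma dist_GH_self:
  assumes "Metric_space Z d" "X \<subseteq> Z"
  shows "dist_GH X d X d = 0"
proof -
  interpret Metric_space Z d by fact
  have id: "isometric_embedding X d Z d (\<lambda>x. x)" using assms(2) by (auto simp: isometric_embedding_def)
  have "dist_GH X d X d \<le> hausdorff_dist d X X" using dist_GH_le[OF assms(1) id id] by simp
  also have "\<dots> \<le> ennreal 0"
    using assms(2) by (intro hausdorff_dist_leI) (metis mdist_zero order_refl subsetD)+
  finally show ?thesis by simp
qed

lemma dist_GH_le_dist_oq:
  fixes A :: "('a::real_vector, 'm) qms_scheme" and B :: "('b::real_vector, 'n) qms_scheme"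
  assumes "order_unit_space A" "order_unit_space B"
  shows "dist_GH (lip_ball A) (ou_dist A) (lip_ball B) (ou_dist B) \<le> dist_oq A B"
  unfolding dist_oq_def
proof (rule Inf_greatest, clarify)
  fix V :: "('a \<times> 'b) set" and N hA hB
  assume V: "normed_space_on V N" and hA: "linear_isometry_into A V N hA"
    and hB: "linear_isometry_into B V N hB"
  have emb: "isometric_embedding (lip_ball C) (ou_dist C) V (norm_dist V N) h"
    if "order_unit_space C" "linear_isometry_into C V N h" for C :: "('c::real_vector, 'k) qms_scheme" and h
    unfolding isometric_embedding_def
  proof (intro conjI ballI)
    interpret order_unit C by unfold_locales fact
    have sub: "lip_ball C \<subseteq> ou_carrier C" by (auto simp: lip_ball_def lip_ball_r_def)
    then show "h \<in> lip_ball C \<rightarrow> V" using that(2) by (auto simp: linear_isometry_into_def)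
    fix x y assume xy: "x \<in> lip_ball C" "y \<in> lip_ball C"
    then have C: "x \<in> ou_carrier C" "y \<in> ou_carrier C" using sub by auto
    have "h (x + (-1) *\<^sub>R y) = h x + (-1) *\<^sub>R h y"
      using C that(2) S_simps(3) by (simp only: linear_isometry_into_def linear_map_on_def)
    then have "h (x - y) = h x - h y" by simp
    then have "N (h x - h y) = ou_norm C (x - y)"
      using C that(2) by (metis S_simps(2) linear_isometry_into_def)
    then show "norm_dist V N (h x) (h y) = ou_dist C x y"
      using C that(2) by (auto simp: norm_dist_def ou_dist_def linear_isometry_into_def)
  qed
  show "dist_GH (lip_ball A) (ou_dist A) (lip_ball B) (ou_dist B) \<le> oq_value A B V N hA hB"
    using dist_GH_le[OF Metric_space_norm_dist[OF V] emb[OF assms(1) hA] emb[OF assms(2) hB]]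
    unfolding oq_value_def by (rule max.coboundedI1)
qed

section \<open>Continuous fields\<close>

locale qms_field =
  fixes A :: "'t::topological_space \<Rightarrow> ('v::real_vector, 'm) qms_scheme"
    and E :: "'t \<Rightarrow> ('v, 'n) ou_space_scheme"
    and \<Gamma> :: "('t \<Rightarrow> 'v) set"
  assumes field: "cont_field_cqms A E \<Gamma>"
begin

abbreviation fibre_norm :: "'t \<Rightarrow> 'v \<Rightarrow> real" ("\<nu>") where "\<nu> t \<equiv> ou_norm (E t)"
abbreviation fibre_unit :: "'t \<Rightarrow> 'v" ("e") where "e t \<equiv> ou_unit (E t)"
abbreviation lip_unit_ball :: "'t \<Rightarrow> 'v set" ("\<D>") where "\<D> t \<equiv> lip_ball (A t)"
abbreviation fibre_radius :: "'t \<Rightarrow> real" ("r") where "r t \<equiv> qms_radius (A t)"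

lemma qms_A: "quantum_metric (A t)" and ou_A: "order_unit (A t)" and ou_E: "order_unit (E t)"
  and space_A: "order_unit_space (A t)"
  and unit_eq: "ou_unit (A t) = e t" and carrier_subset: "ou_carrier (A t) \<subseteq> ou_carrier (E t)"
proof -
  show "quantum_metric (A t)" using field by (simp add: cont_field_cqms_def quantum_metric_def)
  have c: "ou_completion (A t) (E t)" using field by (simp add: cont_field_cqms_def)
  then show "order_unit (A t)" "order_unit (E t)" "order_unit_space (A t)" "ou_unit (A t) = e t"
    and "ou_carrier (A t) \<subseteq> ou_carrier (E t)"
    by (auto simp: ou_completion_def order_unit_def dense_for_def)
qed

lemma norm_eq:
  assumes "x \<in> ou_carrier (A t)"
  shows "ou_norm (A t) x = \<nu> t x"
proof -
  interpret order_unit "A t" by (rule ou_A)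
  have le: "ou_le (A t) x y \<longleftrightarrow> ou_le (E t) x y"
    if "x \<in> ou_carrier (A t)" "y \<in> ou_carrier (A t)" for x y
    using field that by (simp add: cont_field_cqms_def ou_completion_def)
  have "ou_le (A t) x (s *\<^sub>R e t) \<longleftrightarrow> ou_le (E t) x (s *\<^sub>R e t)"
    "ou_le (A t) (- (s *\<^sub>R e t)) x \<longleftrightarrow> ou_le (E t) (- (s *\<^sub>R e t)) x" for s
    using assms S_simps(3,4,6) unfolding unit_eq by (simp_all add: le)
  then show ?thesis by (simp add: ou_norm_def unit_eq)
qed

lemma normed_E: "normed_space_on (ou_carrier (E t)) (\<nu> t)"
  using order_unit.normed_space[OF ou_E] .

lemma subspace_A: "subspace (ou_carrier (A t))"
  using order_unit.subspace_S[OF ou_A] .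

lemma lip_ball_iff: "x \<in> \<D> t \<longleftrightarrow> x \<in> ou_carrier (A t) \<and> lip (A t) x \<le> 1 \<and> \<nu> t x \<le> r t"
  by (auto simp: lip_ball_def lip_ball_r_def norm_eq)

lemma lip_ball_subset: "x \<in> \<D> t \<Longrightarrow> x \<in> ou_carrier (A t)" "x \<in> \<D> t \<Longrightarrow> x \<in> ou_carrier (E t)"
  using carrier_subset by (auto simp: lip_ball_iff)

lemma dist_A: "x \<in> \<D> t \<Longrightarrow> y \<in> \<D> t \<Longrightarrow> ou_dist (A t) x y = \<nu> t (x - y)"
  using norm_eq[of "x - y" t] subspace_diff[OF subspace_A] lip_ball_subset(1)
  by (simp add: ou_dist_def norm_dist_def)

lemma section_in: "g \<in> \<Gamma> \<Longrightarrow> g t \<in> ou_carrier (E t)"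
  and section_zero: "(\<lambda>t. 0) \<in> \<Gamma>"
  and section_add: "g \<in> \<Gamma> \<Longrightarrow> h \<in> \<Gamma> \<Longrightarrow> (\<lambda>t. g t + h t) \<in> \<Gamma>"
  and section_scale: "g \<in> \<Gamma> \<Longrightarrow> (\<lambda>t. c *\<^sub>R g t) \<in> \<Gamma>"
  and section_unit: "e \<in> \<Gamma>"
  and section_norm_continuous: "g \<in> \<Gamma> \<Longrightarrow> continuous_on UNIV (\<lambda>t. \<nu> t (g t))"
  using field unfolding cont_field_cqms_def cont_field_ou_def cont_field_banach_def
  by (auto simp: Pi_def)

lemma section_diff: "g \<in> \<Gamma> \<Longrightarrow> h \<in> \<Gamma> \<Longrightarrow> (\<lambda>t. g t - h t) \<in> \<Gamma>"
  using section_add[of g "\<lambda>t. (-1) *\<^sub>R h t"] section_scale[of h "-1"] by simp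

lemma section_combination:
  "finite J \<Longrightarrow> (\<And>j. j \<in> J \<Longrightarrow> g j \<in> \<Gamma>) \<Longrightarrow> (\<lambda>t. \<Sum>j\<in>J. c j *\<^sub>R g j t) \<in> \<Gamma>"
proof (induction J rule: finite_induct)
  case (insert j J)
  then show ?case using section_add[OF section_scale, of "g j"] by simp
qed (simp add: section_zero)

lemma section_norm_tendsto: "g \<in> \<Gamma> \<Longrightarrow> ((\<lambda>t. \<nu> t (g t)) \<longlongrightarrow> \<nu> s (g s)) (nhds s)"
  using section_norm_continuous[of g] tendsto_at_iff_tendsto_nhds[of "\<lambda>t. \<nu> t (g t)" s]
  by (simp add: continuous_on_def)

lemma section_norm_less: "g \<in> \<Gamma> \<Longrightarrow> \<nu> s (g s) < b \<Longrightarrow> \<forall>\<^sub>F t in nhds s. \<nu> t (g t) < b"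
  using order_tendstoD(2)[OF section_norm_tendsto] .

lemma section_norm_greater: "g \<in> \<Gamma> \<Longrightarrow> b < \<nu> s (g s) \<Longrightarrow> \<forall>\<^sub>F t in nhds s. b < \<nu> t (g t)"
  using order_tendstoD(1)[OF section_norm_tendsto] .

text \<open>A finite bound for the extended Lip-norm includes that the value lies in the dense subspace on
  which the Lip-norm is finite.\<close>

lemma approximating_section:
  assumes "x \<in> ou_carrier (A s)" "lip (A s) x \<le> 1" "\<eta> > 0"
  obtains g where "g \<in> \<Gamma>" "\<nu> s (g s - x) < \<eta>"
    "\<forall>\<^sub>F t in nhds s. g t \<in> ou_carrier (A t) \<and> lip (A t) (g t) < 1 + \<eta>"
proof -
  obtain g where g: "g \<in> lip_sections A \<Gamma> s" "\<nu> s (g s - x) < \<eta>"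
    and lt: "lip_ext (A s) (g s) < ennreal (lip (A s) x + \<eta>)"
    using field assms(1,3) unfolding cont_field_cqms_def by blast
  have "lip_ext (A s) (g s) < ennreal (1 + \<eta>)"
    by (rule less_le_trans[OF lt]) (simp add: ennreal_leI assms(2))
  then have "\<forall>\<^sub>F t in nhds s. lip_ext (A t) (g t) < ennreal (1 + \<eta>)"
    using g(1) unfolding lip_sections_def upper_semicont_at_def by blast
  then have "\<forall>\<^sub>F t in nhds s. g t \<in> ou_carrier (A t) \<and> lip (A t) (g t) < 1 + \<eta>"
  proof (rule eventually_mono)
    fix t assume "lip_ext (A t) (g t) < ennreal (1 + \<eta>)"
    then show "g t \<in> ou_carrier (A t) \<and> lip (A t) (g t) < 1 + \<eta>"
      by (auto simp: lip_ext_def split: if_splits) (metis ennreal_leI not_le)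
  qed
  then show ?thesis using that g by (auto simp: lip_sections_def)
qed

text \<open>Take an element at s with Lip-norm at most 1 and almost maximal oscillation and approximate it by a
  section. Its oscillation, written in terms of the norms of K e + g and K e - g, is continuous at
  s and bounded at t by 2 r t times a Lip-norm that is hardly larger than 1.\<close>

lemma radius_lower_semicontinuous:
  assumes "b < r s"
  shows "\<forall>\<^sub>F t in nhds s. b < r t"
proof (cases "b < 0")
  case True
  then show ?thesis
    using quantum_metric.radius_nonneg[OF qms_A] by (intro always_eventually allI) (rule less_le_trans)
next
  case False
  \<comment> \<open>Small enough to absorb both the factor 1 + \<eta> and the approximation errors.\<close>
  define \<eta> where "\<eta> = (r s - b) / 4 / (b + 2)"
  have \<eta>: "\<eta> > 0" using assms False by (simp add: \<eta>_def)
  have \<eta>b: "b * (1 + \<eta>) < r s - 2 * \<eta>"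
  proof -
    have "\<eta> * (b + 2) = (r s - b) / 4"
      using False nonzero_eq_divide_eq[of "b + 2" \<eta> "(r s - b) / 4"] by (simp only: \<eta>_def) linarith
    then have "b * (1 + \<eta>) + 2 * \<eta> = b + (r s - b) / 4" by (simp add: algebra_simps)
    also have "\<dots> < r s" using assms by (simp add: field_simps)
    finally show ?thesis by (simp only: less_diff_eq)
  qed
  interpret s: quantum_metric "A s" by (rule qms_A)
  obtain \<mu> \<kappa> x where \<mu>: "\<mu> \<in> states (A s)" and \<kappa>: "\<kappa> \<in> states (A s)"
    and x: "x \<in> ou_carrier (A s)" "lip (A s) x \<le> 1" and osc: "\<mu> x - \<kappa> x > 2 * r s - \<eta>"
    using s.oscillation_near_diameter[OF \<eta>] by blast
  obtain g where g: "g \<in> \<Gamma>" "\<nu> s (g s - x) < \<eta>"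
    and ev: "\<forall>\<^sub>F t in nhds s. g t \<in> ou_carrier (A t) \<and> lip (A t) (g t) < 1 + \<eta>"
    using approximating_section[OF x \<eta>] by blast
  have gs: "g s \<in> ou_carrier (A s)" using eventually_nhds_x_imp_x[OF ev] by simp
  define K where "K = \<nu> s (g s) + 1"
  define g1 where "g1 t = g t + K *\<^sub>R e t" for t
  define g2 where "g2 t = K *\<^sub>R e t - g t" for t
  have g12: "g1 \<in> \<Gamma>" "g2 \<in> \<Gamma>"
    unfolding g1_def g2_def by (intro section_add section_diff section_scale section_unit g)+
  have lower: "2 * r s - 3 * \<eta> < \<nu> s (g1 s) + \<nu> s (g2 s) - 2 * K"
  proof -
    have d: "\<bar>\<tau> (g s) - \<tau> x\<bar> < \<eta>" if "\<tau> \<in> states (A s)" for \<tau>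
      using s.states_D(7)[OF that, of "g s - x"] s.states_D(5)[OF that gs x(1)] gs x(1) g(2)
        norm_eq[of "g s - x" s] by simp
    have "\<mu> (g s) - \<kappa> (g s) \<le> ou_norm (A s) (g1 s) + ou_norm (A s) (g2 s) - 2 * K"
      using s.state_difference_le_norms[OF \<mu> \<kappa> gs, of K] by (simp add: g1_def g2_def unit_eq)
    moreover have "ou_norm (A s) (g1 s) = \<nu> s (g1 s)" "ou_norm (A s) (g2 s) = \<nu> s (g2 s)"
      using gs s.e_in by (auto intro!: norm_eq simp: g1_def g2_def simp flip: unit_eq)
    ultimately show ?thesis using d[OF \<mu>] d[OF \<kappa>] osc by linarith
  qed
  have "((\<lambda>t. \<nu> t (g1 t) + \<nu> t (g2 t) - 2 * K) \<longlongrightarrow> \<nu> s (g1 s) + \<nu> s (g2 s) - 2 * K) (nhds s)"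
    by (intro tendsto_intros section_norm_tendsto g12)
  then have "\<forall>\<^sub>F t in nhds s. 2 * r s - 3 * \<eta> < \<nu> t (g1 t) + \<nu> t (g2 t) - 2 * K"
    using lower by (rule order_tendstoD)
  moreover have "\<forall>\<^sub>F t in nhds s. \<nu> t (g t) < K"
    by (rule section_norm_less[OF g(1)]) (simp add: K_def)
  ultimately show ?thesis using ev
  proof eventually_elim
    case (elim t)
    interpret t: quantum_metric "A t" by (rule qms_A)
    have gt: "g t \<in> ou_carrier (A t)" using elim by simp
    have "ou_norm (A t) (g1 t) = \<nu> t (g1 t)" "ou_norm (A t) (g2 t) = \<nu> t (g2 t)"
      using gt t.e_in by (auto intro!: norm_eq simp: g1_def g2_def simp flip: unit_eq)
    moreover have "ou_norm (A t) (g1 t) + ou_norm (A t) (g2 t) - 2 * K \<le> 2 * r t * (1 + \<eta>)"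
      using t.shifted_norms_le[OF gt, of "1 + \<eta>" K] elim \<eta> norm_eq[OF gt]
      by (simp add: g1_def g2_def unit_eq)
    ultimately have "2 * r s - 3 * \<eta> < 2 * (r t * (1 + \<eta>))" using elim by linarith
    then have "b * (1 + \<eta>) < r t * (1 + \<eta>)" using \<eta>b \<eta> by linarith
    then show ?case using \<eta> by simp
  qed
qed

text \<open>The section that approximates x has Lip-norm below 1 + \<eta> near s and norm below r s + \<eta> at s.
  The factor 1 / (1 + \<kappa>) corrects both, and leaves the norm strictly below the radius, so that
  semicontinuity of the radius gives the bound nearby. This needs a positive radius; if the radius
  is 0, the ball consists of 0 only and the zero section does.\<close>

lemma lip_ball_section:
  assumes x: "x \<in> \<D> s" and \<epsilon>: "\<epsilon> > 0"
  obtains g where "g \<in> \<Gamma>" "\<nu> s (g s - x) < \<epsilon>" "\<forall>\<^sub>F t in nhds s. g t \<in> \<D> t"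
proof (cases "r s = 0")
  case True
  then have "\<nu> s x = 0"
    using x normed_space_D(2)[OF normed_E lip_ball_subset(2)[OF x]] by (simp add: lip_ball_iff)
  then have "x = 0" using normed_space_D(8)[OF normed_E lip_ball_subset(2)[OF x]] by simp
  then have "\<nu> s (0 - x) < \<epsilon>" using \<epsilon> normed_space_D(5)[OF normed_E] by simp
  then show ?thesis
    using that[OF section_zero] quantum_metric.zero_in_lip_ball[OF qms_A] by simp
next
  case False
  then have r: "r s > 0" using quantum_metric.radius_nonneg[OF qms_A, of s] by simp
  define \<eta> where "\<eta> = (\<epsilon> / 2) / (3 + r s)"
  define \<kappa> where "\<kappa> = \<eta> + 2 * \<eta> / r s"
  have \<eta>: "\<eta> > 0" using r \<epsilon> by (simp add: \<eta>_def)
  have \<kappa>: "\<kappa> \<ge> \<eta>" "\<kappa> > 0" and \<kappa>r: "\<kappa> * r s = \<eta> * r s + 2 * \<eta>"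
    using r \<eta> by (simp_all add: \<kappa>_def distrib_right add_pos_pos)
  have "\<eta> * (3 + r s) = \<epsilon> / 2"
    using r nonzero_eq_divide_eq[of "3 + r s" \<eta> "\<epsilon> / 2"] by (simp only: \<eta>_def) linarith
  then have \<eta>\<epsilon>: "\<eta> * (3 + r s) < \<epsilon>" using \<epsilon> by simp
  note xD = x[unfolded lip_ball_iff]
  obtain g where g: "g \<in> \<Gamma>" "\<nu> s (g s - x) < \<eta>"
    and ev: "\<forall>\<^sub>F t in nhds s. g t \<in> ou_carrier (A t) \<and> lip (A t) (g t) < 1 + \<eta>"
    using approximating_section[of x s \<eta>] xD \<eta> by blast
  note D = normed_space_D[OF normed_E]
  have in_E: "x \<in> ou_carrier (E s)" "g s \<in> ou_carrier (E s)"
    using lip_ball_subset(2)[OF x] section_in[OF g(1)] by auto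
  note sub = subspace_scale[OF D(1)] subspace_diff[OF D(1)]
  have gs: "\<nu> s (g s) < r s + \<eta>"
    using D(9)[OF in_E(2,1)] g(2) xD by linarith
  define h where "h t = inverse (1 + \<kappa>) *\<^sub>R g t" for t
  have h: "h \<in> \<Gamma>" unfolding h_def by (rule section_scale[OF g(1)])
  have hn: "\<nu> s (h s) < r s"
  proof -
    have "\<nu> s (h s) = \<nu> s (g s) / (1 + \<kappa>)" using D(4)[OF in_E(2)] \<kappa> by (simp add: h_def field_simps)
    also have "\<dots> < r s"
    proof -
      have "0 < \<eta> * r s" using \<eta> r by simp
      then have "\<nu> s (g s) < r s * (1 + \<kappa>)" using gs \<kappa>r \<eta> by (simp add: algebra_simps)
      then show ?thesis using \<kappa> by (simp add: pos_divide_less_eq)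
    qed
    finally show ?thesis .
  qed
  have "\<nu> s (h s - x) < \<epsilon>"
  proof -
    have "h s - x = inverse (1 + \<kappa>) *\<^sub>R (g s - x - \<kappa> *\<^sub>R x)"
    proof -
      have "inverse (1 + \<kappa>) *\<^sub>R (g s - x - \<kappa> *\<^sub>R x) = h s - inverse (1 + \<kappa>) *\<^sub>R ((1 + \<kappa>) *\<^sub>R x)"
        by (simp add: h_def algebra_simps)
      then show ?thesis using \<kappa> by simp
    qed
    then have "\<nu> s (h s - x) = inverse (1 + \<kappa>) * \<nu> s (g s - x - \<kappa> *\<^sub>R x)"
      using D(4)[of "g s - x - \<kappa> *\<^sub>R x" s "inverse (1 + \<kappa>)"] in_E \<kappa> sub by simp
    also have "\<dots> \<le> 1 * \<nu> s (g s - x - \<kappa> *\<^sub>R x)"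
      using \<kappa> in_E sub by (intro mult_right_mono D(2)) (auto simp: inverse_le_1_iff)
    also have "\<dots> \<le> \<nu> s (g s - x) + \<nu> s (\<kappa> *\<^sub>R x)" using D(7) in_E sub by simp
    also have "\<dots> \<le> \<eta> + \<kappa> * r s"
      using g(2) D(4)[OF in_E(1), of \<kappa>] \<kappa> xD by (intro add_mono) auto
    also have "\<dots> < \<epsilon>" using \<eta>\<epsilon> \<kappa>r by (simp add: algebra_simps)
    finally show ?thesis .
  qed
  moreover obtain b where b: "\<nu> s (h s) < b" "b < r s" using dense[OF hn] by blast
  have "\<forall>\<^sub>F t in nhds s. h t \<in> \<D> t"
    using section_norm_less[OF h b(1)] radius_lower_semicontinuous[OF b(2)] ev
  proof eventually_elim
    case (elim t)
    have "h t \<in> ou_carrier (A t)" using elim subspace_scale[OF subspace_A] by (simp add: h_def)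
    moreover have "lip (A t) (h t) \<le> 1"
    proof -
      have "lip (A t) (h t) = lip (A t) (g t) / (1 + \<kappa>)"
        using elim quantum_metric.L_scale[OF qms_A, of "g t" t "inverse (1 + \<kappa>)"] \<kappa>
        by (simp add: h_def divide_inverse_commute)
      then show ?thesis using elim \<kappa> by simp
    qed
    ultimately show ?case using elim by (simp add: lip_ball_iff)
  qed
  ultimately show ?thesis using that h by blast
qed

text \<open>By homogeneity it is enough to consider coefficients whose absolute values sum to 1. Rounding them
  to multiples of 1/K changes the combinations by at most \<delta>/3 in norm, uniformly for t near s,
  and there are only finitely many rounded combinations, each of them a continuous section.\<close>

lemma combination_norms_converge:
  assumes J: "finite J" and g: "\<And>j. j \<in> J \<Longrightarrow> g j \<in> \<Gamma>" and \<delta>: "\<delta> > 0"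
  shows "\<forall>\<^sub>F t in nhds s. \<forall>c. \<bar>\<nu> t (\<Sum>j\<in>J. c j *\<^sub>R g j t) - \<nu> s (\<Sum>j\<in>J. c j *\<^sub>R g j s)\<bar>
    \<le> \<delta> * (\<Sum>j\<in>J. \<bar>c j\<bar>)"
proof -
  define G where "G c t = (\<Sum>j\<in>J. c j *\<^sub>R g j t)" for c t
  define B where "B = (\<Sum>j\<in>J. \<nu> s (g j s)) + 1"
  note D = normed_space_D[OF normed_E]
  have g_in: "g j t \<in> ou_carrier (E t)" if "j \<in> J" for j t using section_in[OF g[OF that]] .
  have B: "\<nu> s (g j s) < B" if "j \<in> J" for j
  proof -
    have "\<nu> s (g j s) \<le> (\<Sum>j\<in>J. \<nu> s (g j s))"
      using that J by (intro member_le_sum D(2) g_in) auto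
    then show ?thesis by (simp add: B_def)
  qed
  have "B > 0" unfolding B_def using D(2)[OF g_in] by (intro add_nonneg_pos sum_nonneg) auto
  obtain K :: nat where K: "3 * real (card J) * B / \<delta> < real K" using reals_Archimedean2 by blast
  have "0 \<le> 3 * real (card J) * B / \<delta>" using \<open>B > 0\<close> \<delta> by simp
  then have "K > 0" using K by (metis of_nat_0_less_iff order_le_less_trans)
  have KB: "real (card J) * (1 / real K * B) \<le> \<delta> / 3"
    using K \<delta> \<open>K > 0\<close> by (simp add: field_simps)
  define Q where "Q = PiE J (\<lambda>_. (\<lambda>i. real_of_int i / real K) ` {- int K .. int K})"
  have Q: "finite Q" unfolding Q_def using J by (intro finite_PiE) auto
  have G: "G c \<in> \<Gamma>" for c
    unfolding G_def by (intro section_combination J g)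
  have "\<forall>\<^sub>F t in nhds s. \<bar>\<nu> t (G c t) - \<nu> s (G c s)\<bar> < \<delta> / 3" for c
    using tendstoD[OF section_norm_tendsto[OF G], of "\<delta> / 3"] \<delta> by (simp add: dist_real_def)
  then have "\<forall>\<^sub>F t in nhds s. \<forall>c\<in>Q. \<bar>\<nu> t (G c t) - \<nu> s (G c s)\<bar> < \<delta> / 3"
    using Q by (simp add: eventually_ball_finite)
  moreover have "\<forall>\<^sub>F t in nhds s. \<forall>j\<in>J. \<nu> t (g j t) < B"
    using section_norm_less[OF g B] J by (simp add: eventually_ball_finite)
  ultimately show ?thesis
  proof eventually_elim
    case (elim t)
    have sum1: "\<bar>\<nu> t (G c t) - \<nu> s (G c s)\<bar> \<le> \<delta>" if c: "(\<Sum>j\<in>J. \<bar>c j\<bar>) = 1" for c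
    proof -
      define d where "d = restrict (\<lambda>j. real_of_int \<lfloor>real K * c j\<rfloor> / real K) J"
      have cd: "\<bar>c j - d j\<bar> \<le> 1 / real K" if "j \<in> J" for j
      proof -
        have "\<bar>real K * c j - real_of_int \<lfloor>real K * c j\<rfloor>\<bar> \<le> 1" by linarith
        moreover have "c j - d j = (real K * c j - real_of_int \<lfloor>real K * c j\<rfloor>) / real K"
          using that \<open>K > 0\<close> by (simp add: d_def diff_divide_distrib)
        ultimately show ?thesis by (simp add: abs_divide divide_right_mono)
      qed
      have "d \<in> Q"
      proof -
        have "\<lfloor>real K * c j\<rfloor> \<in> {- int K .. int K}" if "j \<in> J" for j
        proof -
          have "\<bar>c j\<bar> \<le> (\<Sum>j\<in>J. \<bar>c j\<bar>)" using that J by (intro member_le_sum) auto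
          then have "\<bar>real K * c j\<bar> \<le> real K" using c by (simp add: abs_mult mult_left_le)
          then show ?thesis by (auto simp: le_floor_iff floor_le_iff)
        qed
        then show ?thesis by (auto simp: Q_def d_def)
      qed
      have near: "\<bar>\<nu> x (G c x) - \<nu> x (G d x)\<bar> \<le> \<delta> / 3" if bound: "\<And>j. j \<in> J \<Longrightarrow> \<nu> x (g j x) \<le> B" for x
      proof -
        have "\<bar>\<nu> x (G c x) - \<nu> x (G d x)\<bar> \<le> \<nu> x (G c x - G d x)"
          by (intro D(9) section_in G)
        also have "G c x - G d x = (\<Sum>j\<in>J. (c j - d j) *\<^sub>R g j x)"
          by (simp add: G_def sum_subtractf scaleR_diff_left)
        also have "\<nu> x \<dots> \<le> (\<Sum>j\<in>J. \<bar>c j - d j\<bar> * \<nu> x (g j x))"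
          by (rule normed_space_sum_le[OF normed_E J g_in])
        also have "\<dots> \<le> (\<Sum>j\<in>J. 1 / real K * B)"
          using cd bound D(2)[OF g_in] by (intro sum_mono mult_mono) auto
        also have "\<dots> \<le> \<delta> / 3" using KB by simp
        finally show ?thesis .
      qed
      have "\<bar>\<nu> t (G c t) - \<nu> t (G d t)\<bar> \<le> \<delta> / 3" "\<bar>\<nu> s (G c s) - \<nu> s (G d s)\<bar> \<le> \<delta> / 3"
        using elim B by (auto intro!: near intro: less_imp_le simp del: le_divide_eq_numeral1)
      moreover have "\<bar>\<nu> t (G d t) - \<nu> s (G d s)\<bar> < \<delta> / 3" using elim \<open>d \<in> Q\<close> by blast
      ultimately show ?thesis by linarith
    qed
    have "\<bar>\<nu> t (G c t) - \<nu> s (G c s)\<bar> \<le> \<delta> * (\<Sum>j\<in>J. \<bar>c j\<bar>)" for c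
    proof (cases "(\<Sum>j\<in>J. \<bar>c j\<bar>) = 0")
      case True
      then have "G c x = 0" for x using J by (simp add: G_def sum_nonneg_eq_0_iff)
      then show ?thesis using True D(5) by simp
    next
      case False
      define m where "m = (\<Sum>j\<in>J. \<bar>c j\<bar>)"
      have "m \<ge> 0" unfolding m_def by (simp add: sum_nonneg)
      then have m: "m > 0" using False by (metis m_def order_le_less)
      have Gm: "G c x = m *\<^sub>R G (\<lambda>j. c j / m) x" for x
        using m by (simp add: G_def scaleR_sum_right)
      have "(\<Sum>j\<in>J. \<bar>c j / m\<bar>) = 1"
        using m by (simp add: abs_divide m_def flip: sum_divide_distrib)
      then have le: "\<bar>\<nu> t (G (\<lambda>j. c j / m) t) - \<nu> s (G (\<lambda>j. c j / m) s)\<bar> \<le> \<delta>" by (rule sum1)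
      have nm: "\<nu> x (G c x) = m * \<nu> x (G (\<lambda>j. c j / m) x)" for x
        using D(4)[OF section_in[OF G]] m by (simp add: Gm[of x])
      have "\<bar>\<nu> t (G c t) - \<nu> s (G c s)\<bar> = m * \<bar>\<nu> t (G (\<lambda>j. c j / m) t) - \<nu> s (G (\<lambda>j. c j / m) s)\<bar>"
        using m by (simp add: nm abs_mult flip: right_diff_distrib)
      also have "\<dots> \<le> m * \<delta>" using le m by (intro mult_left_mono) auto
      finally show ?thesis by (simp add: m_def mult.commute)
    qed
    then show ?case by (simp add: G_def)
  qed
qed

end

section \<open>Convergence of the Lipschitz balls\<close>

lemma ennreal_tendsto_zero_iff:
  fixes h :: "'t \<Rightarrow> ennreal"
  shows "(h \<longlongrightarrow> 0) F \<longleftrightarrow> (\<forall>\<epsilon>>0. \<forall>\<^sub>F t in F. h t < ennreal \<epsilon>)"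
proof (intro iffI allI impI)
  fix \<epsilon> :: real assume "(h \<longlongrightarrow> 0) F" "0 < \<epsilon>"
  then show "\<forall>\<^sub>F t in F. h t < ennreal \<epsilon>" by (intro order_tendstoD) auto
next
  assume *: "\<forall>\<epsilon>>0. \<forall>\<^sub>F t in F. h t < ennreal \<epsilon>"
  show "(h \<longlongrightarrow> 0) F"
  proof (rule order_tendstoI)
    fix a :: ennreal assume "0 < a"
    have "\<exists>\<epsilon>>0. ennreal \<epsilon> \<le> a"
    proof (cases a)
      case (real x)
      then show ?thesis using \<open>0 < a\<close> by (intro exI[of _ x]) auto
    qed (auto intro: exI[of _ 1])
    then obtain \<epsilon> where "\<epsilon> > 0" "ennreal \<epsilon> \<le> a" by blast
    then show "\<forall>\<^sub>F t in F. h t < a" using * by (auto elim!: eventually_mono intro: less_le_trans)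
  qed simp
qed

context qms_field
begin

text \<open>A maximal \<sigma>-separated family in the ball at s has all its distances at least m, for some m greater
  than \<sigma>. This gap leaves room for passing to sections that approximate the family (which costs
  2 \<kappa> at t near s) and for mapping points of the ball at t back to the ball at s (another 2 \<kappa>).
  Any further point of the ball at t would therefore contradict maximality.\<close>

lemma cover_of_GH_convergence:
  assumes f: "\<And>n. f n \<in> \<Gamma>" and fD: "\<And>n::nat. f n s \<in> \<D> s"
    and dense: "dense_for (ou_dist (A s)) (range (\<lambda>n. f n s)) (\<D> s)"
    and GH: "((\<lambda>t. dist_GH (\<D> t) (ou_dist (A t)) (\<D> s) (ou_dist (A s))) \<longlongrightarrow> 0) (nhds s)"
    and \<epsilon>: "\<epsilon> > 0"
  shows "\<exists>N. \<forall>\<^sub>F t in nhds s. \<forall>y\<in>\<D> t. \<exists>n<N. \<nu> t (f n t - y) < \<epsilon>"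
proof -
  note D = normed_space_D[OF normed_E]
  define \<sigma> where "\<sigma> = \<epsilon> / 4"
  define sep where "sep k p \<longleftrightarrow> (\<forall>i<k. p i \<in> \<D> s) \<and>
    (\<forall>i<k. \<forall>j<k. i \<noteq> j \<longrightarrow> \<sigma> < \<nu> s (p i - p j))" for k :: nat and p
  have "\<exists>n0::nat. \<forall>k p. (\<forall>i<k. p i \<in> \<D> s) \<longrightarrow>
      (\<forall>i<k. \<forall>j<k. i \<noteq> j \<longrightarrow> \<sigma> < ou_norm (A s) (p i - p j)) \<longrightarrow> k \<le> n0"
    using quantum_metric.lip_ball_r_packing[OF qms_A, of \<sigma> s "r s"] \<epsilon>
    unfolding lip_ball_def \<sigma>_def by simp
  then obtain n0 where n0: "\<And>k p. (\<forall>i<k. p i \<in> \<D> s) \<Longrightarrow>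
      (\<forall>i<k. \<forall>j<k. i \<noteq> j \<longrightarrow> \<sigma> < ou_norm (A s) (p i - p j)) \<Longrightarrow> k \<le> (n0::nat)" by blast
  have bound: "k \<le> n0" if "sep k p" for k p
  proof (rule n0)
    show "\<forall>i<k. p i \<in> \<D> s" using that by (simp add: sep_def)
    show "\<forall>i<k. \<forall>j<k. i \<noteq> j \<longrightarrow> \<sigma> < ou_norm (A s) (p i - p j)"
    proof (intro allI impI)
      fix i j assume ij: "i < k" "j < k" "i \<noteq> j"
      have "p i - p j \<in> ou_carrier (A s)"
        using that ij by (intro subspace_diff[OF subspace_A] lip_ball_subset) (auto simp: sep_def)
      then show "\<sigma> < ou_norm (A s) (p i - p j)" using that ij by (simp add: sep_def norm_eq)
    qed
  qed
  have "\<exists>n. (\<exists>p. sep n p) \<and> (\<forall>k. (\<exists>p. sep k p) \<longrightarrow> k \<le> n)"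
    using bound by (intro ex_has_greatest_nat[of "\<lambda>n. \<exists>p. sep n p" 0 "\<lambda>n. n" "Suc n0"])
      (auto simp: sep_def less_Suc_eq_le)
  then obtain n p where sep: "sep n p" and max: "\<And>k q. sep k q \<Longrightarrow> k \<le> n" by blast
  have pD: "p i \<in> \<D> s" if "i < n" for i using sep that by (simp add: sep_def)
  \<comment> \<open>The value \<epsilon> / 2 caps m, as the final cover must have radius below \<epsilon>, and handles families with
      fewer than two points.\<close>
  define M where "M = insert (\<epsilon> / 2) ((\<lambda>(i, j). \<nu> s (p i - p j)) ` ({..<n} \<times> {..<n} - Id))"
  define m where "m = Min M"
  have M: "finite M" "M \<noteq> {}" by (auto simp: M_def)
  have m_le: "m \<le> \<epsilon> / 2" "\<And>i j. i < n \<Longrightarrow> j < n \<Longrightarrow> i \<noteq> j \<Longrightarrow> m \<le> \<nu> s (p i - p j)"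
  proof -
    have M_in: "\<epsilon> / 2 \<in> M" "\<And>i j. i < n \<Longrightarrow> j < n \<Longrightarrow> i \<noteq> j \<Longrightarrow> \<nu> s (p i - p j) \<in> M"
      by (auto simp: M_def)
    show "m \<le> \<epsilon> / 2" "\<And>i j. i < n \<Longrightarrow> j < n \<Longrightarrow> i \<noteq> j \<Longrightarrow> m \<le> \<nu> s (p i - p j)"
      unfolding m_def by (rule Min_le[OF M(1)], rule M_in)+
  qed
  have "\<sigma> < m"
  proof -
    have "\<sigma> < x" if "x \<in> M" for x using that sep \<epsilon> by (auto simp: M_def sep_def \<sigma>_def)
    then show ?thesis unfolding m_def using M by simp
  qed
  define \<kappa> where "\<kappa> = (m - \<sigma>) / 8"
  have \<kappa>: "\<kappa> > 0" "m = \<sigma> + 8 * \<kappa>" using \<open>\<sigma> < m\<close> by (auto simp: \<kappa>_def field_simps)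
  have "\<exists>g\<in>\<Gamma>. \<nu> s (g s - p i) < \<kappa> \<and> (\<forall>\<^sub>F t in nhds s. g t \<in> \<D> t)" if "i < n" for i
    using lip_ball_section[OF pD[OF that] \<kappa>(1)] by metis
  then obtain g where g: "\<And>i. i < n \<Longrightarrow> g i \<in> \<Gamma>" "\<And>i. i < n \<Longrightarrow> \<nu> s (g i s - p i) < \<kappa>"
    "\<And>i. i < n \<Longrightarrow> \<forall>\<^sub>F t in nhds s. g i t \<in> \<D> t" by metis
  have "\<exists>k. \<nu> s (f k s - p i) < \<kappa>" if "i < n" for i
    using dense pD[OF that] \<kappa>(1) dist_A[OF fD pD[OF that]] unfolding dense_for_def by fastforce
  then obtain q where q: "\<And>i. i < n \<Longrightarrow> \<nu> s (f (q i) s - p i) < \<kappa>" by metis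
  obtain N where N: "\<And>i. i < n \<Longrightarrow> q i < N"
    using finite_nat_set_iff_bounded[of "q ` {..<n}"] by auto
  have in_E: "g i t \<in> ou_carrier (E t)" "f j t \<in> ou_carrier (E t)" "p i \<in> ou_carrier (E s)"
    if "i < n" for i j t using section_in g(1) f lip_ball_subset(2)[OF pD] that by auto
  note sub = subspace_diff[OF D(1)]
  have tri: "\<nu> t (x - z) \<le> \<nu> t (x - y) + \<nu> t (y - z)"
    if "x \<in> ou_carrier (E t)" "y \<in> ou_carrier (E t)" "z \<in> ou_carrier (E t)" for t x y z
    using D(3)[of "x - y" t "y - z"] sub that by simp
  have "\<forall>\<^sub>F t in nhds s. \<forall>i\<in>{..<n}. g i t \<in> \<D> t" using g(3) by (simp add: eventually_ball_finite)
  moreover have "\<forall>\<^sub>F t in nhds s. \<forall>i\<in>{..<n}. \<nu> t (f (q i) t - g i t) < 2 * \<kappa>"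
  proof (intro eventually_ball_finite ballI)
    fix i assume i: "i \<in> {..<n}"
    have "\<nu> s (f (q i) s - g i s) < 2 * \<kappa>"
      using tri[of "f (q i) s" s "p i" "g i s"] q[of i] g(2)[of i] D(10)[of "p i" s "g i s"] in_E[of i] i
      by auto
    then show "\<forall>\<^sub>F t in nhds s. \<nu> t (f (q i) t - g i t) < 2 * \<kappa>"
      using i section_norm_less[OF section_diff[OF f g(1)]] by auto
  qed simp
  moreover have "\<forall>\<^sub>F t in nhds s. \<forall>i\<in>{..<n}. \<forall>j\<in>{..<n}. i \<noteq> j \<longrightarrow> m - 2 * \<kappa> < \<nu> t (g i t - g j t)"
  proof (intro eventually_ball_finite ballI)
    fix i j assume ij: "i \<in> {..<n}" "j \<in> {..<n}"
    show "\<forall>\<^sub>F t in nhds s. i \<noteq> j \<longrightarrow> m - 2 * \<kappa> < \<nu> t (g i t - g j t)"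
    proof (cases "i = j")
      case False
      have "\<nu> s (p i - p j) \<le> \<nu> s (p i - g i s) + \<nu> s (g i s - g j s) + \<nu> s (g j s - p j)"
        using tri[of "p i" s "g i s" "p j"] tri[of "g i s" s "g j s" "p j"] in_E ij by fastforce
      then have "m - 2 * \<kappa> < \<nu> s (g i s - g j s)"
        using m_le(2)[of i j] False ij g(2)[of i] g(2)[of j] D(10)[of "p i" s "g i s"] in_E[of i] by auto
      then show ?thesis
        using ij section_norm_greater[OF section_diff[OF g(1) g(1)]] by auto
    qed simp
  qed simp_all
  moreover have "\<forall>\<^sub>F t in nhds s. dist_GH (\<D> t) (ou_dist (A t)) (\<D> s) (ou_dist (A s)) < ennreal \<kappa>"
    using GH \<kappa>(1) unfolding ennreal_tendsto_zero_iff by blast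
  ultimately have "\<forall>\<^sub>F t in nhds s. \<forall>y\<in>\<D> t. \<exists>n<N. \<nu> t (f n t - y) < \<epsilon>"
  proof eventually_elim
    case (elim t)
    obtain \<phi> where \<phi>: "\<phi> \<in> \<D> t \<rightarrow> \<D> s"
      "\<forall>x\<in>\<D> t. \<forall>x'\<in>\<D> t. ou_dist (A t) x x' < ou_dist (A s) (\<phi> x) (\<phi> x') + 2 * \<kappa>"
      using dist_GH_lessD[OF elim(4)] by blast
    show ?case
    proof (rule ccontr)
      assume "\<not> ?case"
      then obtain y where y: "y \<in> \<D> t" "\<And>n. n < N \<Longrightarrow> \<epsilon> \<le> \<nu> t (f n t - y)"
        by (metis not_less)
      have far: "m - 2 * \<kappa> \<le> \<nu> t (g i t - y)" if i: "i < n" for i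
      proof -
        have "\<epsilon> \<le> \<nu> t (f (q i) t - y)" using y(2) N[OF i] by simp
        also have "\<dots> \<le> \<nu> t (f (q i) t - g i t) + \<nu> t (g i t - y)"
          using in_E[OF i] lip_ball_subset(2)[OF y(1)] by (intro tri) auto
        finally have "\<epsilon> \<le> \<nu> t (f (q i) t - g i t) + \<nu> t (g i t - y)" .
        moreover have "\<nu> t (f (q i) t - g i t) < 2 * \<kappa>" using elim(2) i by simp
        ultimately show ?thesis using m_le(1) \<epsilon> by simp
      qed
      define p' where "p' i = (if i < n then g i t else y)" for i
      have p'D: "p' i \<in> \<D> t" for i using elim(1) y(1) by (simp add: p'_def)
      have p'_far: "m - 2 * \<kappa> \<le> \<nu> t (p' i - p' j)" if "i < Suc n" "j < Suc n" "i \<noteq> j" for i j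
      proof -
        have "\<nu> t (y - g k t) = \<nu> t (g k t - y)" if "k < n" for k
          using D(10)[of y t "g k t"] in_E[OF that] lip_ball_subset(2)[OF y(1)] by simp
        then show ?thesis using that far elim(3) by (auto simp: p'_def less_Suc_eq less_imp_le)
      qed
      have "sep (Suc n) (\<lambda>i. \<phi> (p' i))"
        unfolding sep_def
      proof (intro conjI allI impI)
        fix i show in_D: "\<phi> (p' i) \<in> \<D> s" for i using \<phi>(1) p'D by auto
        fix j assume ij: "i < Suc n" "j < Suc n" "i \<noteq> j"
        have "\<nu> t (p' i - p' j) < \<nu> s (\<phi> (p' i) - \<phi> (p' j)) + 2 * \<kappa>"
          using \<phi>(2) p'D dist_A[OF p'D p'D] dist_A[OF in_D in_D] by metis
        then show "\<sigma> < \<nu> s (\<phi> (p' i) - \<phi> (p' j))" using p'_far[OF ij] \<kappa> by linarith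
      qed
      then show False using max by fastforce
    qed
  qed
  then show ?thesis by blast
qed

text \<open>In the amalgamated norm, a point x of the ball at t is close to f n t for some n, hence to f n s,
  which belongs to the ball at s. In the other direction f n t need not lie in the ball at t, so
  the approximations g n of f n with values in the balls take its place.\<close>

lemma dist_oq_small_of_cover:
  assumes f: "\<And>n. f n \<in> \<Gamma>" and fD: "\<And>n::nat. f n s \<in> \<D> s" and \<epsilon>: "\<epsilon> > 0"
    and cover: "\<forall>\<^sub>F t in nhds s. \<forall>y\<in>\<D> t. \<exists>n<N. \<nu> t (f n t - y) < \<epsilon>"
  shows "\<forall>\<^sub>F t in nhds s. dist_oq (A t) (A s) \<le> ennreal (3 * \<epsilon>)"
proof -
  note D = normed_space_D[OF normed_E]
  \<comment> \<open>Chosen such that \<delta> and \<delta> times the radius r s are at most \<epsilon>.\<close>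
  define \<delta> where "\<delta> = \<epsilon> / (1 + r s)"
  have rs: "0 \<le> r s" using quantum_metric.radius_nonneg[OF qms_A] .
  then have \<delta>: "\<delta> > 0" using \<epsilon> by (simp add: \<delta>_def)
  have "\<delta> * (1 + r s) = \<epsilon>" using rs by (simp add: \<delta>_def)
  then have \<delta>1: "\<delta> + \<delta> * r s = \<epsilon>" by (simp add: algebra_simps)
  moreover have "0 \<le> \<delta> * r s" using \<delta> rs by simp
  ultimately have \<delta>_le: "\<delta> \<le> \<epsilon>" "r s * \<delta> \<le> \<epsilon>" using \<delta> by (auto simp: mult.commute)
  have "\<exists>g\<in>\<Gamma>. \<nu> s (g s - f n s) < \<epsilon> \<and> (\<forall>\<^sub>F t in nhds s. g t \<in> \<D> t)" for n
    using lip_ball_section[OF fD \<epsilon>] by metis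
  then obtain g where g: "\<And>n. g n \<in> \<Gamma>" "\<And>n. \<nu> s (g n s - f n s) < \<epsilon>"
    "\<And>n. \<forall>\<^sub>F t in nhds s. g n t \<in> \<D> t" by metis
  define J where "J = f ` {..<N} \<union> g ` {..<N} \<union> {e}"
  have J: "finite J" "J \<subseteq> \<Gamma>" using f g(1) section_unit by (auto simp: J_def)
  have cover_s: "\<forall>y\<in>\<D> s. \<exists>n<N. \<nu> s (f n s - y) < \<epsilon>" using eventually_nhds_x_imp_x[OF cover] .
  have "\<forall>\<^sub>F t in nhds s. \<forall>n\<in>{..<N}. g n t \<in> \<D> t" using g(3) by (simp add: eventually_ball_finite)
  moreover have "\<forall>\<^sub>F t in nhds s. \<forall>n\<in>{..<N}. \<nu> t (f n t) < r s + \<epsilon>"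
  proof (intro eventually_ball_finite ballI)
    fix n
    have "\<nu> s (f n s) < r s + \<epsilon>" using fD[of n] \<epsilon> by (simp add: lip_ball_iff)
    then show "\<forall>\<^sub>F t in nhds s. \<nu> t (f n t) < r s + \<epsilon>" by (rule section_norm_less[OF f])
  qed simp
  moreover have "\<forall>\<^sub>F t in nhds s. r s - \<epsilon> < r t" using \<epsilon> by (intro radius_lower_semicontinuous) simp
  moreover have "\<forall>\<^sub>F t in nhds s. \<forall>c. \<bar>\<nu> t (\<Sum>h\<in>J. c h *\<^sub>R h t) - \<nu> s (\<Sum>h\<in>J. c h *\<^sub>R h s)\<bar>
      \<le> \<delta> * (\<Sum>h\<in>J. \<bar>c h\<bar>)"
    using combination_norms_converge[OF J(1), of "\<lambda>h. h" \<delta> s] J(2) \<delta> by blast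
  ultimately show ?thesis using cover
  proof eventually_elim
    case (elim t)
    let ?V = "ou_carrier (E t) \<times> ou_carrier (E s)"
    have in_E: "h x \<in> ou_carrier (E x)" if "h \<in> J" for h x using J(2) section_in that by blast
    have inJ: "f n \<in> J" "g n \<in> J" if "n < N" for n using that by (auto simp: J_def)
    obtain P where P: "normed_space_on ?V P" "\<And>x. x \<in> ou_carrier (E t) \<Longrightarrow> P (x, 0) = \<nu> t x"
      "\<And>y. y \<in> ou_carrier (E s) \<Longrightarrow> P (0, y) = \<nu> s y" "\<And>h. h \<in> J \<Longrightarrow> P (h t, - h s) \<le> \<delta>"
    proof -
      have "\<exists>P. normed_space_on ?V P \<and> (\<forall>x\<in>ou_carrier (E t). P (x, 0) = \<nu> t x) \<and>
          (\<forall>y\<in>ou_carrier (E s). P (0, y) = \<nu> s y) \<and> (\<forall>h\<in>J. P (h t, - h s) \<le> \<delta>)"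
        by (rule amalgamated_norm[OF normed_E normed_E J(1) _ _ \<delta>]) (use in_E elim(4) in auto)
      then show ?thesis using that by blast
    qed
    note DP = normed_space_D[OF P(1)]
    note sub = subspace_scale[OF D(1)] subspace_diff[OF D(1)] subspace_neg[OF D(1)] subspace_0[OF D(1)]
    \<comment> \<open>The images of x and y differ by (x, - y), in accordance with the sign in the amalgamated norm.\<close>
    define a where "a x = (x, 0 :: 'v)" for x :: 'v
    define b where "b y = (0 :: 'v, y)" for y :: 'v
    have ab: "norm_dist ?V P (a x) (b y) = P (x, - y)"
      if "x \<in> ou_carrier (E t)" "y \<in> ou_carrier (E s)" for x y
      using that sub by (simp add: norm_dist_def a_def b_def)
    have lin_a: "linear_isometry_into (A t) ?V P a"
      unfolding linear_isometry_into_def linear_map_on_def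
      using carrier_subset[of t] P(2) sub by (auto simp: a_def norm_eq)
    have lin_b: "linear_isometry_into (A s) ?V P b"
      unfolding linear_isometry_into_def linear_map_on_def
      using carrier_subset[of s] P(3) sub by (auto simp: b_def norm_eq)
    have P_add: "P (x, - y) \<le> P (x', - y') + P (x'', - y'')"
      if "x = x' + x''" "y = y' + y''" "x' \<in> ou_carrier (E t)" "x'' \<in> ou_carrier (E t)"
        "y' \<in> ou_carrier (E s)" "y'' \<in> ou_carrier (E s)" for x y x' y' x'' y''
      using DP(3)[of "(x', - y')" "(x'', - y'')"] that sub by simp
    have e_in: "e x \<in> ou_carrier (E x)" for x using section_in[OF section_unit] .
    have from_t: "\<exists>y\<in>\<D> s. P (x, - y) \<le> 3 * \<epsilon>" if x: "x \<in> \<D> t" for x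
    proof -
      obtain n where n: "n < N" "\<nu> t (f n t - x) < \<epsilon>" using elim(5) x by blast
      note fin = in_E[OF inJ(1)[OF n(1)]] and xin = lip_ball_subset(2)[OF x]
      have "P (x, - f n s) \<le> P (x - f n t, - 0) + P (f n t, - f n s)"
        using fin xin sub by (intro P_add) auto
      also have "P (x - f n t, - 0) = \<nu> t (f n t - x)"
        using P(2)[of "x - f n t"] D(10)[OF fin xin] fin xin sub by simp
      finally have "P (x, - f n s) \<le> 3 * \<epsilon>" using n(2) P(4)[OF inJ(1)[OF n(1)]] \<delta>_le \<epsilon> by linarith
      then show ?thesis using fD by blast
    qed
    have from_s: "\<exists>x\<in>\<D> t. P (x, - y) \<le> 3 * \<epsilon>" if y: "y \<in> \<D> s" for y
    proof -
      obtain n where n: "n < N" "\<nu> s (f n s - y) < \<epsilon>" using cover_s y by blast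
      note fin = in_E[OF inJ(1)[OF n(1)]] and gin = in_E[OF inJ(2)[OF n(1)]] and yin = lip_ball_subset(2)[OF y]
      have "P (g n t, - y) \<le> P (g n t, - g n s) + P (0, - (y - g n s))"
        using gin yin sub by (intro P_add) auto
      also have "P (0, - (y - g n s)) = \<nu> s (g n s - y)"
        using P(3)[of "g n s - y"] gin yin sub by simp
      also have "\<nu> s (g n s - y) \<le> \<nu> s (g n s - f n s) + \<nu> s (f n s - y)"
        using D(3)[of "g n s - f n s" s "f n s - y"] gin fin yin sub by simp
      finally have "P (g n t, - y) \<le> 3 * \<epsilon>"
        using n(2) g(2)[of n] P(4)[OF inJ(2)[OF n(1)]] \<delta>_le by linarith
      then show ?thesis using elim(1) n(1) by blast
    qed
    have unit: "P (r t *\<^sub>R e t, - (r s *\<^sub>R e s)) \<le> 3 * \<epsilon>"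
    proof -
      have rt: "0 \<le> r t" using quantum_metric.radius_nonneg[OF qms_A] .
      have ne: "\<nu> t (c *\<^sub>R e t) = \<bar>c\<bar>" for c
        using D(4)[OF e_in] order_unit.norm_e[OF ou_E] by simp
      have "r t *\<^sub>R e t \<in> \<D> t" using quantum_metric.unit_in_lip_ball[OF qms_A, of t] by (simp add: unit_eq)
      then obtain n where n: "n < N" "\<nu> t (f n t - r t *\<^sub>R e t) < \<epsilon>" using elim(5) by blast
      have "\<bar>\<nu> t (f n t) - \<nu> t (r t *\<^sub>R e t)\<bar> < \<epsilon>"
        using D(9)[of "f n t" t "r t *\<^sub>R e t"] in_E[OF inJ(1)[OF n(1)]] e_in sub n(2) by fastforce
      moreover have "\<nu> t (f n t) < r s + \<epsilon>" using elim(2) n(1) by blast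
      ultimately have "r t < r s + 2 * \<epsilon>" using ne[of "r t"] rt by linarith
      then have d: "\<bar>r t - r s\<bar> \<le> 2 * \<epsilon>" using elim(3) \<epsilon> by linarith
      have "P (r t *\<^sub>R e t, - (r s *\<^sub>R e s)) \<le> P ((r t - r s) *\<^sub>R e t, - 0) + P (r s *\<^sub>R e t, - (r s *\<^sub>R e s))"
        using e_in sub by (intro P_add) (auto simp: algebra_simps)
      also have "P ((r t - r s) *\<^sub>R e t, - 0) = \<bar>r t - r s\<bar>"
        using P(2)[OF sub(1)[OF e_in]] ne by simp
      also have "P (r s *\<^sub>R e t, - (r s *\<^sub>R e s)) = r s * P (e t, - e s)"
        using DP(4)[of "(e t, - e s)" "r s"] e_in sub rs by simp
      also have "r s * P (e t, - e s) \<le> r s * \<delta>"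
        using P(4)[of e] rs by (intro mult_left_mono) (auto simp: J_def)
      finally show ?thesis using d \<delta>_le by linarith
    qed
    have "dist_oq (A t) (A s) \<le> oq_value (A t) (A s) ?V P a b"
      by (rule dist_oq_le[OF space_A space_A P(1) lin_a lin_b])
    also have "\<dots> \<le> ennreal (3 * \<epsilon>)"
      unfolding oq_value_def unit_eq
    proof (rule max.boundedI)
      show "hausdorff_dist (norm_dist ?V P) (a ` \<D> t) (b ` \<D> s) \<le> ennreal (3 * \<epsilon>)"
        using from_t from_s ab lip_ball_subset(2) by (intro hausdorff_dist_leI) fastforce+
      show "ennreal (norm_dist ?V P (a (r t *\<^sub>R e t)) (b (r s *\<^sub>R e s))) \<le> ennreal (3 * \<epsilon>)"
        using unit ab[OF sub(1)[OF e_in] sub(1)[OF e_in]] by (simp add: ennreal_leI)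
    qed
    finally show ?case .
  qed
qed

lemma GH_self: "dist_GH (\<D> s) (ou_dist (A s)) (\<D> s) (ou_dist (A s)) = 0"
  unfolding ou_dist_def
  using Metric_space_norm_dist[OF order_unit.normed_space[OF ou_A]] lip_ball_subset(1)
  by (intro dist_GH_self[of "ou_carrier (A s)"]) auto

lemma in_mball_iff:
  assumes "g \<in> \<Gamma>" "y \<in> \<D> t"
  shows "y \<in> Metric_space.mball (ou_carrier (E t)) (ou_dist (E t)) (g t) \<epsilon> \<longleftrightarrow> \<nu> t (g t - y) < \<epsilon>"
  using Metric_space.in_mball[OF Metric_space_norm_dist[OF normed_E]] section_in[OF assms(1)]
    lip_ball_subset(2)[OF assms(2)]
  by (simp add: ou_dist_def norm_dist_def)

end

theorem theorem1p2:
  fixes A :: "'t::t2_space \<Rightarrow> 'v::real_vector qms"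
    and E :: "'t \<Rightarrow> 'v ou_space"
    and \<Gamma> :: "('t \<Rightarrow> 'v) set"
    and t0 :: 't
    and f :: "nat \<Rightarrow> 't \<Rightarrow> 'v"
  assumes "locally_compact_space (euclidean :: 't topology)"
    and "cont_field_cqms A E \<Gamma>"
    and "\<And>n. f n \<in> \<Gamma>"
    and "\<And>n. f n t0 \<in> lip_ball (A t0)"
    and "dense_for (ou_dist (A t0)) (range (\<lambda>n. f n t0)) (lip_ball (A t0))"
  shows "(((\<lambda>t. dist_oq (A t) (A t0)) \<longlongrightarrow> 0) (at t0) \<longleftrightarrow>
          ((\<lambda>t. dist_GH (lip_ball (A t)) (ou_dist (A t)) (lip_ball (A t0)) (ou_dist (A t0)))
             \<longlongrightarrow> 0) (at t0)) \<and>
         (((\<lambda>t. dist_GH (lip_ball (A t)) (ou_dist (A t)) (lip_ball (A t0)) (ou_dist (A t0)))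
             \<longlongrightarrow> 0) (at t0) \<longleftrightarrow>
          (\<forall>\<epsilon>>0. \<exists>N::nat. \<exists>U. open U \<and> t0 \<in> U \<and>
             (\<forall>t\<in>U. lip_ball (A t) \<subseteq>
                (\<Union>n<N. Metric_space.mball (ou_carrier (E t)) (ou_dist (E t)) (f n t) \<epsilon>))))"
    (is "(?oq \<longleftrightarrow> ?GH) \<and> (?GH \<longleftrightarrow> ?cover)")
proof -
  interpret qms_field A E \<Gamma> by unfold_locales fact
  have ball: "lip_ball (A t) \<subseteq> (\<Union>n<N. Metric_space.mball (ou_carrier (E t)) (ou_dist (E t)) (f n t) \<epsilon>)
      \<longleftrightarrow> (\<forall>y\<in>lip_ball (A t). \<exists>n<N. ou_norm (E t) (f n t - y) < \<epsilon>)" for t N \<epsilon>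
    using in_mball_iff[OF assms(3)] by (auto simp: subset_iff)
  have cover_iff: "?cover \<longleftrightarrow> (\<forall>\<epsilon>>0. \<exists>N. \<forall>\<^sub>F t in nhds t0.
      \<forall>y\<in>lip_ball (A t). \<exists>n<N. ou_norm (E t) (f n t - y) < \<epsilon>)"
    unfolding ball eventually_nhds by auto
  have "?GH" if ?oq
  proof (rule tendsto_sandwich[OF _ _ tendsto_const that])
    show "\<forall>\<^sub>F t in at t0. dist_GH (lip_ball (A t)) (ou_dist (A t)) (lip_ball (A t0)) (ou_dist (A t0))
        \<le> dist_oq (A t) (A t0)"
      by (intro always_eventually allI dist_GH_le_dist_oq space_A)
  qed simp
  moreover have "?cover" if ?GH
  proof -
    have "((\<lambda>t. dist_GH (lip_ball (A t)) (ou_dist (A t)) (lip_ball (A t0)) (ou_dist (A t0)))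
        \<longlongrightarrow> 0) (nhds t0)"
      using that tendsto_at_iff_tendsto_nhds[of
          "\<lambda>t. dist_GH (lip_ball (A t)) (ou_dist (A t)) (lip_ball (A t0)) (ou_dist (A t0))" t0]
      by (simp add: GH_self)
    then show ?thesis
      unfolding cover_iff using cover_of_GH_convergence[OF assms(3-5)] by blast
  qed
  moreover have "?oq" if ?cover
    unfolding ennreal_tendsto_zero_iff
  proof (intro allI impI)
    fix \<epsilon> :: real assume \<epsilon>: "\<epsilon> > 0"
    obtain N where "\<forall>\<^sub>F t in nhds t0. \<forall>y\<in>lip_ball (A t). \<exists>n<N. ou_norm (E t) (f n t - y) < \<epsilon> / 4"
    proof -
      have "\<epsilon> / 4 > 0" using \<epsilon> by simp
      then have "\<exists>N. \<forall>\<^sub>F t in nhds t0. \<forall>y\<in>lip_ball (A t). \<exists>n<N. ou_norm (E t) (f n t - y) < \<epsilon> / 4"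
        using \<open>?cover\<close> unfolding cover_iff by blast
      then show ?thesis using that by blast
    qed
    then have "\<forall>\<^sub>F t in nhds t0. dist_oq (A t) (A t0) \<le> ennreal (3 * (\<epsilon> / 4))"
      using \<epsilon> by (intro dist_oq_small_of_cover[OF assms(3,4)]) auto
    then have "\<forall>\<^sub>F t in nhds t0. dist_oq (A t) (A t0) < ennreal \<epsilon>"
      by (rule eventually_mono) (use \<epsilon> in \<open>auto elim!: le_less_trans intro!: ennreal_lessI\<close>)
    then show "\<forall>\<^sub>F t in at t0. dist_oq (A t) (A t0) < ennreal \<epsilon>"
      unfolding eventually_nhds_conv_at by blast
  qed
  ultimately show ?thesis by blast
qed

end
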